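(* Define \begin{align*} \vartheta_8(a_0,\dots,a_7)&:=\frac{1}{8J_4}\Big[a_0\overline{J}_{4,8}\overline{J}_{28,64}+a_1q^4\overline{J}_{0,8}\overline{J}_{52,64}+a_2q\overline{J}_{4,8}\overline{J}_{20,64}+a_3q\overline{J}_{0,8}\overline{J}_{28,64}\\ &\qquad+a_4q^2\overline{J}_{0,8}\overline{J}_{20,64}+a_5q^6\overline{J}_{4,8}\overline{J}_{60,64}+a_6q^3\overline{J}_{4,8}\overline{J}_{52,64}+a_7q^7\overline{J}_{0,8}\overline{J}_{60,64}\Big], \end{align*} \[ \vartheta_8'(c_0,c_1,c_2,c_3):=\frac{1}{2J_4}\Big[c_0J_{4,8}\overline{J}_{28,64}+c_1qJ_{4,8}\overline{J}_{20,64}+c_2q^6J_{4,8}\overline{J}_{60,64}+c_3q^3J_{4,8}\overline{J}_{52,64}\Big]. \] Then \begin{align*} D_C(0,8)&=\vartheta_8(3,-1,1,-3,-1,3,1,-3)+\vartheta_8'(1,-1,-1,1),\\ D_C(1,8)=D_C(7,8)&=\vartheta_8(-1,-1,1,1,-1,-1,1,1)+\vartheta_8'(0,1,0,-1),\\ D_C(2,8)=D_C(6,8)&=\vartheta_8(-1,3,-3,1,3,-1,-3,1),\\ D_C(3,8)=D_C(5,8)&=\vartheta_8(-1,-1,1,1,-1,-1,1,1)+\vartheta_8'(0,-1,0,1),\\ D_C(4,8)&=\vartheta_8(3,-1,1,-3,-1,3,1,-3)+\vartheta_8'(-1,1,1,-1). \end{align*}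
   Context: Throughout, $q$ is a complex number with $0<|q|<1$. Write $(x)_\infty=(x;q)_\infty=\prod_{i\ge0}(1-q^ix)$. Let $j(x;q)=(x)_\infty(q/x)_\infty(q)_\infty=\sum_{n\in\mathbb Z}(-1)^nq^{\binom n2}x^n$. For integers $a$ and $m\ge1$: $J_{a,m}=j(q^a;q^m)$, $\overline{J}_{a,m}=j(-q^a;q^m)$, and $J_m=J_{m,3m}=\prod_{i\ge1}(1-q^{mi})$. Cranks: define integers $C(m,n)$ ($m\in\mathbb Z$, $n\ge0$) by $\sum_{n\ge0}\sum_{m\in\mathbb Z}C(m,n)z^mq^n=\prod_{n\ge1}\frac{1-q^n}{(1-zq^n)(1-z^{-1}q^n)}$. For $n\ge2$, $C(m,n)$ is the number of partitions $\pi$ of $n$ with crank $m$, where the crank of $\pi$ is its largest part if $\pi$ has no parts equal to $1$, and otherwise $\mu(\pi)-\nu(\pi)$ with $\nu(\pi)$ the number of ones and $\mu(\pi)$ the number of parts larger than $\nu(\pi)$; for $n\le1$ the generating function gives $C(0,0)=1$, $C(1,1)=C(-1,1)=1$, $C(0,1)=-1$, all other values $0$. For $M\ge1$ and integer $a$, $C(a,M;n)=\sum_{m\equiv a\pmod M}C(m,n)$. Let $p(n)$ be the number of partitions of $n$ ($p(0)=1$). The crank deviation is $D_C(a,M)=\sum_{n\ge0}\big(C(a,M;n)-p(n)/M\big)q^n$. *)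

theory Defs
  imports "HOL-Analysis.Analysis" "HOL-Library.Multiset"
begin

definition qpoch :: "complex \<Rightarrow> complex \<Rightarrow> complex" where
  "qpoch x q = (\<Prod>i. 1 - q ^ i * x)"

definition jtheta :: "complex \<Rightarrow> complex \<Rightarrow> complex" where
  "jtheta x q = qpoch x q * qpoch (q / x) q * qpoch q q"

definition Jam :: "nat \<Rightarrow> nat \<Rightarrow> complex \<Rightarrow> complex" where
  "Jam a m q = jtheta (q ^ a) (q ^ m)"

definition Jbar :: "nat \<Rightarrow> nat \<Rightarrow> complex \<Rightarrow> complex" where
  "Jbar a m q = jtheta (- (q ^ a)) (q ^ m)"

definition Jm :: "nat \<Rightarrow> complex \<Rightarrow> complex" where
  "Jm m q = Jam m (3 * m) q"

definition partitions_of :: "nat \<Rightarrow> nat multiset set" where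
  "partitions_of n = {P. (\<forall>x\<in>#P. 0 < x) \<and> sum_mset P = n}"

definition npart :: "nat \<Rightarrow> nat" where
  "npart n = card (partitions_of n)"

definition crank :: "nat multiset \<Rightarrow> int" where
  "crank P = (if count P 1 = 0 then int (Max (set_mset P))
              else int (size (filter_mset (\<lambda>x. count P 1 < x) P)) - int (count P 1))"

text \<open>C(m,n): number of partitions of n with crank m for n >= 2; explicit values for n <= 1
  (as dictated by the generating function).\<close>
definition crank_count :: "int \<Rightarrow> nat \<Rightarrow> int" where
  "crank_count m n =
     (if n = 0 then (if m = 0 then 1 else 0)
      else if n = 1 then (if m = 1 \<or> m = -1 then 1 else if m = 0 then -1 else 0)
      else int (card {P \<in> partitions_of n. crank P = m}))"

definition crank_res :: "int \<Rightarrow> nat \<Rightarrow> nat \<Rightarrow> complex" where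
  "crank_res a M n = (\<Sum>\<^sub>\<infinity> m \<in> {m::int. m mod int M = a mod int M}. of_int (crank_count m n))"

definition crank_dev :: "int \<Rightarrow> nat \<Rightarrow> complex \<Rightarrow> complex" where
  "crank_dev a M q = (\<Sum>n. (crank_res a M n - of_nat (npart n) / of_nat M) * q ^ n)"

definition theta8 :: "complex \<Rightarrow> complex \<Rightarrow> complex \<Rightarrow> complex \<Rightarrow> complex \<Rightarrow> complex
    \<Rightarrow> complex \<Rightarrow> complex \<Rightarrow> complex \<Rightarrow> complex" where
  "theta8 q a0 a1 a2 a3 a4 a5 a6 a7 =
     1 / (8 * Jm 4 q) *
     (a0 * Jbar 4 8 q * Jbar 28 64 q
      + a1 * q ^ 4 * Jbar 0 8 q * Jbar 52 64 q
      + a2 * q * Jbar 4 8 q * Jbar 20 64 q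
      + a3 * q * Jbar 0 8 q * Jbar 28 64 q
      + a4 * q ^ 2 * Jbar 0 8 q * Jbar 20 64 q
      + a5 * q ^ 6 * Jbar 4 8 q * Jbar 60 64 q
      + a6 * q ^ 3 * Jbar 4 8 q * Jbar 52 64 q
      + a7 * q ^ 7 * Jbar 0 8 q * Jbar 60 64 q)"

definition theta8' :: "complex \<Rightarrow> complex \<Rightarrow> complex \<Rightarrow> complex \<Rightarrow> complex \<Rightarrow> complex" where
  "theta8' q c0 c1 c2 c3 =
     1 / (2 * Jm 4 q) *
     (c0 * Jam 4 8 q * Jbar 28 64 q
      + c1 * q * Jam 4 8 q * Jbar 20 64 q
      + c2 * q ^ 6 * Jam 4 8 q * Jbar 60 64 q
      + c3 * q ^ 3 * Jam 4 8 q * Jbar 52 64 q)"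

end

theory Submission
  imports Defs
begin

text \<open>
  Sorting partitions by the number of ones (and, when there are none, by the largest part) turns the
  sum of \<open>z\<close> to the crank into two sums that the q-binomial theorem evaluates; the result is the
  Andrews--Garvan product \<open>F(z) = (q)/((zq)(q/z))\<close>. The deviation is then one eighth of the sum of
  \<open>z^(-a) F(z)\<close> over the nontrivial eighth roots of unity \<open>z\<close>. For a primitive root, the factors
  \<open>(1 - zq^n)(1 - q^n/z)\<close> at \<open>z\<close> and at \<open>-z\<close> multiply to \<open>1 + q^(4n)\<close>, so \<open>F(z)\<close> equals
  \<open>j(-z;q)/((1 + z)(-q^4;q^4))\<close>. At \<open>z = \<plusminus>i\<close> it is \<open>\<phi>(-q)\<psi>(q)/J_4\<close> and at \<open>z = -1\<close> it is
  \<open>\<phi>(-q)\<psi>(-q)/J_4\<close>, where \<open>\<phi>(-q) = j(q;q^2)\<close>, \<open>\<psi>(q) = j(-1;q)/2\<close> and \<open>\<psi>(-q) = j(-i;q)/(1 + i)\<close>.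
  Splitting the series of \<open>j(-z;q)\<close> by residues modulo 8 and that of \<open>\<phi>(-q)\<close> modulo 2 gives the claim.
\<close>

section \<open>q-Pochhammer symbols and the q-binomial theorem\<close>

text \<open>Every \<open>z\<close> that matters lies on the unit circle. There the crank weight of a
  partition of n has norm |q|^n, so the sum over all partitions converges absolutely and may be
  regrouped by any statistic; also |q| < |z|, the range in which the triple product is proved. The
  primitive roots account for the \<open>theta8'\<close> part, through 1/(-q^4;q^4) = J_{4,8}/J_4,
  and the roots i, -i and -1 for the \<open>theta8\<close> part. Irrational numbers enter only
  through s = z + 1/z with s^2 = 2: the product at a primitive root is affine in s, and the filter
  weights either cancel the s-term or multiply it by another s, so rational coefficients
  remain.\<close>

lemma qpoch_convergent:
  fixes q x :: complex
  assumes "norm q < 1"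
  shows "convergent_prod (\<lambda>i. 1 - q ^ i * x)"
proof -
  have "summable (\<lambda>i. norm (1 - q ^ i * x - 1))"
    using assms by (simp add: norm_mult norm_power) (intro summable_mult2 summable_geometric, simp)
  then show ?thesis
    by (intro abs_convergent_prod_imp_convergent_prod summable_imp_abs_convergent_prod)
qed

lemma qpoch_LIMSEQ:
  assumes "norm q < 1"
  shows "(\<lambda>n. \<Prod>i<n. 1 - q ^ i * x) \<longlonglongrightarrow> qpoch x q"
proof -
  have "(\<lambda>n. \<Prod>i<Suc n. 1 - q ^ i * x) \<longlonglongrightarrow> qpoch x q"
    using convergent_prod_LIMSEQ[OF qpoch_convergent[OF assms, of x]]
    by (simp add: qpoch_def lessThan_Suc_atMost)
  then show ?thesis
    by (rule LIMSEQ_imp_Suc)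
qed

lemma qpoch_0 [simp]: "qpoch 0 q = 1"
  by (simp add: qpoch_def)

lemma qpoch_nonzero:
  assumes "norm q < 1" and "\<And>i. q ^ i * x \<noteq> 1"
  shows "qpoch x q \<noteq> 0"
  unfolding qpoch_def
  by (rule prodinf_nonzero) (use assms in \<open>auto intro: qpoch_convergent dest: sym\<close>)

lemma qpoch_nonzero':
  assumes "norm q < 1" and "norm x < 1"
  shows "qpoch x q \<noteq> 0"
proof (rule qpoch_nonzero)
  fix i
  have "norm (q ^ i * x) \<le> 1 * norm x"
    unfolding norm_mult norm_power
    by (rule mult_right_mono) (use assms in \<open>auto simp: power_le_one\<close>)
  with assms show "q ^ i * x \<noteq> 1" by auto
qed (use assms in auto)

lemma qpoch_split:
  assumes "norm q < 1"
  shows "qpoch x q = (\<Prod>i<n. 1 - q ^ i * x) * qpoch (q ^ n * x) q"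
proof (rule LIMSEQ_unique)
  show "(\<lambda>m. \<Prod>i<n + m. 1 - q ^ i * x) \<longlonglongrightarrow> qpoch x q"
    using LIMSEQ_ignore_initial_segment[OF qpoch_LIMSEQ[OF assms, of x], of n] by (simp add: add.commute)
  have *: "(\<Prod>i<n + m. 1 - q ^ i * x) = (\<Prod>i<n. 1 - q ^ i * x) * (\<Prod>i<m. 1 - q ^ i * (q ^ n * x))" for m
    by (induction m) (simp_all add: power_add mult_ac)
  show "(\<lambda>m. \<Prod>i<n + m. 1 - q ^ i * x) \<longlonglongrightarrow> (\<Prod>i<n. 1 - q ^ i * x) * qpoch (q ^ n * x) q"
    unfolding * by (intro tendsto_intros qpoch_LIMSEQ assms)
qed

lemma qpoch_Suc:
  assumes "norm q < 1"
  shows "qpoch x q = (1 - x) * qpoch (q * x) q"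
  using qpoch_split[OF assms, of x 1] by simp

lemma norm_power_less_one: "norm (q ^ m) < 1" if "norm q < 1" "0 < m" for q :: complex
  using that by (simp add: norm_power power_less_one_iff)

text \<open>Partial products of length m * n regroup exactly by the residue of the index modulo m;
  the limit is taken along this subsequence.\<close>

lemma qpoch_dissect:
  assumes "norm q < 1" "0 < m"
  shows "qpoch x q = (\<Prod>r<m. qpoch (q ^ r * x) (q ^ m))"
proof (rule LIMSEQ_unique)
  have q: "norm (q ^ m) < 1" using norm_power_less_one assms by blast
  have *: "(\<Prod>i<m * n. 1 - q ^ i * x) = (\<Prod>r<m. \<Prod>i<n. 1 - (q ^ m) ^ i * (q ^ r * x))" for n
  proof (induction n)
    case (Suc n)
    have "(\<Prod>i<m * n + k. 1 - q ^ i * x) = (\<Prod>i<m * n. 1 - q ^ i * x) * (\<Prod>r<k. 1 - (q ^ m) ^ n * (q ^ r * x))" for k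
      by (induction k) (simp_all add: power_add power_mult mult_ac)
    from this[of m] Suc show ?case
      by (simp add: prod.distrib add.commute mult.commute)
  qed auto
  show "(\<lambda>n. \<Prod>i<m * n. 1 - q ^ i * x) \<longlonglongrightarrow> qpoch x q"
    using LIMSEQ_subseq_LIMSEQ[OF qpoch_LIMSEQ[OF assms(1), of x], of "(*) m"] assms(2)
    by (simp add: o_def strict_mono_def)
  show "(\<lambda>n. \<Prod>i<m * n. 1 - q ^ i * x) \<longlonglongrightarrow> (\<Prod>r<m. qpoch (q ^ r * x) (q ^ m))"
    unfolding * by (intro tendsto_prod qpoch_LIMSEQ q)
qed

lemma qpoch_mult_minus:
  assumes "norm q < 1"
  shows "qpoch x q * qpoch (- x) q = qpoch (x ^ 2) (q ^ 2)"
proof (rule LIMSEQ_unique)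
  show "(\<lambda>n. (\<Prod>i<n. 1 - q ^ i * x) * (\<Prod>i<n. 1 - q ^ i * (- x))) \<longlonglongrightarrow> qpoch x q * qpoch (- x) q"
    by (intro tendsto_mult qpoch_LIMSEQ assms)
  have *: "(\<Prod>i<n. 1 - q ^ i * x) * (\<Prod>i<n. 1 - q ^ i * (- x)) = (\<Prod>i<n. 1 - (q ^ 2) ^ i * x ^ 2)" for n
    unfolding prod.distrib[symmetric]
    by (rule prod.cong) (simp_all add: algebra_simps power2_eq_square power_mult_distrib)
  show "(\<lambda>n. (\<Prod>i<n. 1 - q ^ i * x) * (\<Prod>i<n. 1 - q ^ i * (- x))) \<longlonglongrightarrow> qpoch (x ^ 2) (q ^ 2)"
    unfolding * by (intro qpoch_LIMSEQ norm_power_less_one assms) simp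
qed

lemma one_minus_power_nonzero: "1 - q ^ Suc n \<noteq> 0" if "norm q < 1" for q :: complex
  using norm_power_less_one[OF that, of "Suc n"] by (auto simp del: power_Suc)

text \<open>Homogeneous form of the q-binomial coefficients: \<open>(a, b) = (0, 1)\<close> and \<open>(a, b) = (- 1, 0)\<close> give
  Euler's two expansions, and \<open>b = 1\<close> the q-binomial theorem.\<close>
definition qbinc :: "complex \<Rightarrow> complex \<Rightarrow> complex \<Rightarrow> nat \<Rightarrow> complex" where
  "qbinc q a b n = (\<Prod>i<n. (b - a * q ^ i) / (1 - q ^ Suc i))"

lemma qbinc_0 [simp]: "qbinc q a b 0 = 1"
  by (simp add: qbinc_def)

lemma qbinc_Suc:
  assumes "norm q < 1"
  shows "qbinc q a b (Suc n) * (1 - q ^ Suc n) = qbinc q a b n * (b - a * q ^ n)"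
  using one_minus_power_nonzero[OF assms] by (simp add: qbinc_def del: power_Suc)

text \<open>Ratio test: since q^n tends to 0, the ratio of consecutive terms tends to b * t. For b =
  0 every t is allowed.\<close>

lemma qbinc_summable:
  assumes "norm q < 1" "norm (b * t) < 1"
  shows "summable (\<lambda>n. norm (qbinc q a b n * t ^ n))"
proof -
  define R where "R = (\<lambda>n. (b - a * q ^ n) / (1 - q ^ Suc n) * t)"
  have "(\<lambda>n. norm (R n)) \<longlonglongrightarrow> norm ((b - a * 0) / (1 - 0) * t)"
    unfolding R_def
    by (intro tendsto_intros LIMSEQ_power_zero LIMSEQ_Suc[of "\<lambda>n. q ^ n"]) (use assms in auto)
  then have lim: "(\<lambda>n. norm (R n)) \<longlonglongrightarrow> norm (b * t)" by simp
  obtain c where c: "norm (b * t) < c" "c < 1" using assms dense by blast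
  have "eventually (\<lambda>n. norm (R n) < c) sequentially"
    using order_tendstoD(2)[OF lim c(1)] .
  then obtain N where N: "\<And>n. n \<ge> N \<Longrightarrow> norm (R n) < c"
    by (auto simp: eventually_sequentially)
  have step: "qbinc q a b (Suc n) * t ^ Suc n = R n * (qbinc q a b n * t ^ n)" for n
    by (simp add: qbinc_def R_def)
  show ?thesis
  proof (rule summable_ratio_test[OF c(2), of N])
    fix n assume "N \<le> n"
    with N[of n] have "norm (R n) \<le> c" by simp
    then show "norm (norm (qbinc q a b (Suc n) * t ^ Suc n)) \<le> c * norm (norm (qbinc q a b n * t ^ n))"
      unfolding step norm_mult[of "R n"] by (simp add: mult_right_mono)
  qed
qed

text \<open>The recurrence \<open>qbinc_Suc\<close> becomes (1 - b x) f(x) = (1 - a x) f(q x) for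
  the sum f of the series. Iteration moves the argument from t to q^n t, which tends to 0, where f
  is continuous with value 1.\<close>

lemma q_binomial:
  assumes q: "norm q < 1" and bt: "norm (b * t) < 1"
  shows "(\<lambda>n. qbinc q a b n * t ^ n) sums (qpoch (a * t) q / qpoch (b * t) q)"
proof (cases "t = 0")
  case True
  then show ?thesis using powser_sums_zero[of "qbinc q a b"] by simp
next
  case False
  define f where "f = (\<lambda>x. \<Sum>n. qbinc q a b n * x ^ n)"
  have sm: "summable (\<lambda>n. qbinc q a b n * x ^ n)" if "norm (b * x) < 1" for x
    using summable_norm_cancel[OF qbinc_summable[OF q that]] .
  have qn: "norm (b * (q ^ n * t)) < 1" for n
  proof -
    have "norm (b * (q ^ n * t)) = norm q ^ n * norm (b * t)"
      by (simp add: norm_mult norm_power)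
    also have "\<dots> \<le> 1 * norm (b * t)"
      by (rule mult_right_mono) (use q in \<open>auto simp: power_le_one\<close>)
    finally show ?thesis using bt by simp
  qed
  have fe: "(1 - b * x) * f x = (1 - a * x) * f (q * x)" if x: "norm (b * x) < 1" and x': "norm (b * (q * x)) < 1" for x
  proof -
    let ?c = "qbinc q a b"
    have s1: "(\<lambda>n. ?c n * x ^ n) sums f x" and s2: "(\<lambda>n. ?c n * (q * x) ^ n) sums f (q * x)"
      using sm[OF x] sm[OF x'] by (auto simp: f_def)
    have "(\<lambda>n. ?c n * x ^ n - ?c n * (q * x) ^ n) sums (f x - f (q * x))"
      by (intro sums_diff s1 s2)
    then have "(\<lambda>n. ?c (Suc n) * x ^ Suc n - ?c (Suc n) * (q * x) ^ Suc n) sums (f x - f (q * x))"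
      by (subst sums_Suc_iff) simp
    also have "(\<lambda>n. ?c (Suc n) * x ^ Suc n - ?c (Suc n) * (q * x) ^ Suc n)
        = (\<lambda>n. b * x * (?c n * x ^ n) - a * x * (?c n * (q * x) ^ n))"
    proof
      fix n
      have "?c (Suc n) * x ^ Suc n - ?c (Suc n) * (q * x) ^ Suc n = (?c (Suc n) * (1 - q ^ Suc n)) * x ^ Suc n"
        by (simp add: power_mult_distrib algebra_simps)
      also have "\<dots> = b * x * (?c n * x ^ n) - a * x * (?c n * (q * x) ^ n)"
        unfolding qbinc_Suc[OF q] by (simp add: power_mult_distrib algebra_simps)
      finally show "?c (Suc n) * x ^ Suc n - ?c (Suc n) * (q * x) ^ Suc n
          = b * x * (?c n * x ^ n) - a * x * (?c n * (q * x) ^ n)" .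
    qed
    finally have "(\<lambda>n. b * x * (?c n * x ^ n) - a * x * (?c n * (q * x) ^ n)) sums (f x - f (q * x))" .
    moreover have "(\<lambda>n. b * x * (?c n * x ^ n) - a * x * (?c n * (q * x) ^ n)) sums (b * x * f x - a * x * f (q * x))"
      by (intro sums_diff sums_mult s1 s2)
    ultimately have "f x - f (q * x) = b * x * f x - a * x * f (q * x)"
      by (rule sums_unique2)
    then show ?thesis by (simp add: algebra_simps)
  qed
  have iter: "(\<Prod>i<n. 1 - q ^ i * (b * t)) * f t = (\<Prod>i<n. 1 - q ^ i * (a * t)) * f (q ^ n * t)" for n
  proof (induction n)
    case (Suc n)
    have "(\<Prod>i<Suc n. 1 - q ^ i * (b * t)) * f t
        = (1 - b * (q ^ n * t)) * ((\<Prod>i<n. 1 - q ^ i * (b * t)) * f t)"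
      by (simp add: mult_ac)
    also have "\<dots> = (\<Prod>i<n. 1 - q ^ i * (a * t)) * ((1 - b * (q ^ n * t)) * f (q ^ n * t))"
      unfolding Suc by (simp add: mult_ac)
    also have "(1 - b * (q ^ n * t)) * f (q ^ n * t) = (1 - a * (q ^ n * t)) * f (q * (q ^ n * t))"
      using fe[of "q ^ n * t"] qn[of n] qn[of "Suc n"] by (simp add: mult.assoc)
    finally show ?case by (simp add: mult_ac)
  qed simp
  \<comment> \<open>Continuity at 0 is read off from convergence at the nonzero point t; hence the
    separate case t = 0.\<close>
  have cont: "isCont f 0"
    unfolding f_def by (rule isCont_powser[OF sm[OF bt]]) (use False in auto)
  have f0: "f 0 = 1" unfolding f_def by simp
  have "(\<lambda>n. f (q ^ n * t)) \<longlonglongrightarrow> f 0"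
    by (rule isCont_tendsto_compose[OF cont])
       (use LIMSEQ_power_zero[OF q] tendsto_mult_left_zero in blast)
  then have "(\<lambda>n. (\<Prod>i<n. 1 - q ^ i * (a * t)) * f (q ^ n * t)) \<longlonglongrightarrow> qpoch (a * t) q * 1"
    unfolding f0 by (intro tendsto_mult qpoch_LIMSEQ q)
  moreover have "(\<lambda>n. (\<Prod>i<n. 1 - q ^ i * (b * t)) * f t) \<longlonglongrightarrow> qpoch (b * t) q * f t"
    by (intro tendsto_mult qpoch_LIMSEQ q tendsto_const)
  ultimately have "qpoch (b * t) q * f t = qpoch (a * t) q"
    unfolding iter using LIMSEQ_unique by fastforce
  then have "f t = qpoch (a * t) q / qpoch (b * t) q"
    using qpoch_nonzero'[OF q bt] by (simp add: field_simps)
  then show ?thesis using summable_sums[OF sm[OF bt]] by (simp add: f_def)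
qed

section \<open>The Jacobi triple product\<close>

lemma abs_summable_on_Times_mult:
  fixes f :: "'a \<Rightarrow> complex"
  assumes "(\<lambda>x. norm (f x)) summable_on A" "(\<lambda>x. norm (g x)) summable_on B"
  shows "(\<lambda>z. norm (case z of (x, y) \<Rightarrow> f x * g y)) summable_on A \<times> B"
  unfolding Infinite_Sum.abs_summable_on_Sigma_iff
  using assms by (auto simp: norm_mult infsum_cmult_right' abs_mult intro!: summable_on_cmult_right summable_on_cmult_left)

lemma has_sum_Times_mult:
  fixes f :: "'a \<Rightarrow> complex"
  assumes "(\<lambda>x. norm (f x)) summable_on A" "(\<lambda>x. norm (g x)) summable_on B" "(f has_sum a) A" "(g has_sum b) B"
  shows "((\<lambda>(x, y). f x * g y) has_sum (a * b)) (A \<times> B)"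
proof (rule has_sum_SigmaI)
  show "((\<lambda>x. f x * b) has_sum a * b) A" by (rule has_sum_cmult_left assms)+
  show "(\<lambda>(x, y). f x * g y) summable_on A \<times> B"
    using abs_summable_on_Times_mult[OF assms(1,2)] by (rule abs_summable_summable)
qed (auto intro: has_sum_cmult_right assms)

lemma abs_summable_on_UNIV_nat:
  fixes f :: "nat \<Rightarrow> complex"
  assumes "summable (\<lambda>n. norm (f n))"
  shows "(\<lambda>n. norm (f n)) summable_on UNIV"
  using assms by (simp add: norm_summable_imp_summable_on)

lemma sums_imp_has_sum:
  fixes f :: "nat \<Rightarrow> complex"
  assumes "summable (\<lambda>n. norm (f n))" "f sums s"
  shows "(f has_sum s) UNIV"
  using norm_summable_imp_has_sum assms .

text \<open>The binomial coefficient "k choose 2" for all integers k. It is never negative, so a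
  natural number can serve as the exponent of q.\<close>

definition tri :: "int \<Rightarrow> nat" where
  "tri k = nat (k * (k - 1) div 2)"

lemma two_tri: "2 * int (tri k) = k * (k - 1)"
proof -
  have "even (k * (k - 1))" by simp
  moreover have "k * (k - 1) \<ge> 0"
    by (cases "k \<ge> 1") (auto intro: mult_nonneg_nonneg mult_nonpos_nonpos)
  ultimately show ?thesis by (simp add: tri_def)
qed

lemma tri_eqI: "2 * int n = k * (k - 1) \<Longrightarrow> tri k = n"
  using two_tri[of k] by linarith

lemma tri_of_nat: "tri (int n) = n choose 2"
proof (rule tri_eqI)
  have "even (n * (n - 1))" by (cases n) auto
  then have "2 * (n choose 2) = n * (n - 1)" by (simp add: choose_two)
  then have "int (2 * (n choose 2)) = int (n * (n - 1))" by simp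
  also have "\<dots> = int n * (int n - 1)" by (cases n) (auto simp: algebra_simps)
  finally show "2 * int (n choose 2) = int n * (int n - 1)" by simp
qed

lemma tri_nonneg: "0 \<le> k \<Longrightarrow> tri k = nat k choose 2"
  using tri_of_nat[of "nat k"] by simp

lemma qbinc_one: "qbinc q 0 1 n = 1 / (\<Prod>i<n. 1 - q ^ Suc i)"
  by (simp add: qbinc_def prod_dividef)

lemma qbinc_zero: "qbinc q (- 1) 0 n = q ^ (n choose 2) / (\<Prod>i<n. 1 - q ^ Suc i)"
  by (induction n) (simp_all add: qbinc_def numeral_2_eq_2 power_add)

text \<open>Each term is q^n * t times its predecessor, and this factor tends to 0 whatever t
  is.\<close>

lemma summable_theta:
  assumes "norm (q::complex) < 1"
  shows "summable (\<lambda>n. norm (q ^ (n choose 2) * t ^ n))"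
proof -
  have "(\<lambda>n. norm (q ^ n * t)) \<longlonglongrightarrow> norm (0 * t)"
    by (intro tendsto_intros LIMSEQ_power_zero assms)
  then have "eventually (\<lambda>n. norm (q ^ n * t) < 1/2) sequentially"
    by (intro order_tendstoD(2)) auto
  then obtain N where N: "\<And>n. n \<ge> N \<Longrightarrow> norm (q ^ n * t) < 1/2"
    by (auto simp: eventually_sequentially)
  have step: "q ^ (Suc n choose 2) * t ^ Suc n = (q ^ n * t) * (q ^ (n choose 2) * t ^ n)" for n
    by (simp add: numeral_2_eq_2 power_add)
  show ?thesis
  proof (rule summable_ratio_test[of "1/2" N])
    fix n assume "N \<le> n"
    with N[of n] have "norm (q ^ n * t) \<le> 1/2" by simp
    then have "norm (q ^ n * t) * norm (q ^ (n choose 2) * t ^ n) \<le> 1/2 * norm (q ^ (n choose 2) * t ^ n)"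
      by (rule mult_right_mono) simp
    then show "norm (norm (q ^ (Suc n choose 2) * t ^ Suc n)) \<le> 1/2 * norm (norm (q ^ (n choose 2) * t ^ n))"
      unfolding step norm_mult[of "q ^ n * t"] by simp
  qed simp
qed

lemma abs_summable_theta:
  fixes q x :: complex
  assumes "norm q < 1" "x \<noteq> 0"
  shows "(\<lambda>k. norm (q ^ tri k * x powi k)) summable_on UNIV"
proof -
  have "(\<lambda>k. norm (q ^ tri k * x powi k)) summable_on {0..}"
  proof (subst summable_on_reindex_bij_witness[where i = int and j = nat and T = UNIV])
    show "(\<lambda>n. norm (q ^ (n choose 2) * x ^ n)) summable_on UNIV"
      by (intro abs_summable_on_UNIV_nat summable_theta assms)
  qed (auto simp: tri_nonneg power_int_def)
  \<comment> \<open>With k = -n - 1 one has \<open>tri k\<close> = C(n,2) + 2n + 1, so the negative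
    half is q/x times a one-sided theta series in q^2/x.\<close>
  moreover have "(\<lambda>k. norm (q ^ tri k * x powi k)) summable_on {..<0}"
  proof (subst summable_on_reindex_bij_witness[where i = "\<lambda>n. - int n - 1" and j = "\<lambda>k. nat (- k - 1)" and T = UNIV])
    show "(\<lambda>n. norm ((q / x) * (q ^ (n choose 2) * (q ^ 2 / x) ^ n))) summable_on UNIV"
      unfolding norm_mult[of "q / x"]
      by (intro summable_on_cmult_right abs_summable_on_UNIV_nat summable_theta assms)
    fix k :: int assume "k \<in> {..<0}"
    then obtain n where k: "k = - int n - 1" 
      by (metis lessThan_iff zless_iff_Suc_zadd add.commute add_diff_cancel_left' diff_add_cancel add_uminus_conv_diff minus_diff_eq minus_minus of_nat_Suc uminus_add_conv_diff diff_0 diff_diff_eq2 neg_0_less_iff_less)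
    have "tri k = (n choose 2) + 2 * n + 1"
      by (rule tri_eqI) (use two_tri[of "int n"] in \<open>simp add: k tri_of_nat algebra_simps\<close>)
    moreover have "x powi k = inverse x * inverse x ^ n"
      using assms(2) unfolding k by (simp add: power_int_diff power_int_minus field_simps)
    ultimately show "norm (q / x * (q ^ (nat (- k - 1) choose 2) * (q\<^sup>2 / x) ^ nat (- k - 1))) = norm (q ^ tri k * x powi k)"
      by (simp add: k power_add power_mult_distrib power_mult field_simps power_divide power2_eq_square)
  qed auto
  ultimately have "(\<lambda>k. norm (q ^ tri k * x powi k)) summable_on ({0..} \<union> {..<0})"
    by (rule summable_on_union)
  also have "{0..} \<union> {..<0} = (UNIV :: int set)" by auto
  finally show ?thesis .
qed

text \<open>Both Euler expansions applied to the double sum of \<open>g (k + m) h m\<close>, where \<open>g\<close> is the theta series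
  and \<open>h\<close> the series of \<open>1/(-q/x)\<close>: summing over \<open>k\<close> first gives the theta series over \<open>(-q/x)\<close>, summing
  over \<open>m\<close> first gives \<open>(-x)(q)\<close>, because \<open>(q^(k+1))\<close> vanishes for \<open>k < 0\<close>. The hypothesis on \<open>x\<close> is the
  convergence of \<open>h\<close>.\<close>
theorem jacobi_triple_product:
  assumes q: "norm q < 1" "q \<noteq> 0" and x: "norm q < norm x"
  shows "((\<lambda>k. q ^ tri k * x powi k) has_sum jtheta (- x) q) UNIV"
proof -
  define g where "g = (\<lambda>k. q ^ tri k * x powi k)"
  define h where "h = (\<lambda>m. qbinc q 0 1 m * (- (q / x)) ^ m)"
  define D where "D = (\<lambda>n. \<Prod>i<n. 1 - q ^ Suc i)"
  have x0: "x \<noteq> 0" using x q by auto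
  have qx: "norm (- (q / x)) < 1" using x x0 by (simp add: norm_divide)
  have D0: "D n \<noteq> 0" for n
    unfolding D_def using one_minus_power_nonzero[OF q(1)] by simp
  have g: "(\<lambda>k. norm (g k)) summable_on UNIV"
    unfolding g_def by (rule abs_summable_theta[OF q(1) x0])
  then have Theta: "(g has_sum infsum g UNIV) UNIV"
    by (simp add: abs_summable_summable)
  have "summable (\<lambda>m. norm (h m))"
    unfolding h_def using qbinc_summable[of q 1 "- (q / x)" 0] q qx by simp
  moreover have "h sums (1 / qpoch (- (q / x)) q)"
    unfolding h_def using q_binomial[of q 1 "- (q / x)" 0] q qx by simp
  ultimately have h: "(\<lambda>m. norm (h m)) summable_on UNIV" "(h has_sum (1 / qpoch (- (q / x)) q)) UNIV"
    by (auto intro: abs_summable_on_UNIV_nat sums_imp_has_sum)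
  have "((\<lambda>(k, m). g k * h m) has_sum (infsum g UNIV * (1 / qpoch (- (q / x)) q))) (UNIV \<times> UNIV)"
    by (intro has_sum_Times_mult g h Theta)
  also have "?this \<longleftrightarrow> ((\<lambda>(k, m). g (k + int m) * h m) has_sum (infsum g UNIV * (1 / qpoch (- (q / x)) q))) (UNIV \<times> UNIV)"
    by (rule has_sum_reindex_bij_witness[where j = "\<lambda>(k, m). (k - int m, m)" and i = "\<lambda>(k, m). (k + int m, m)"]) auto
  finally have prod_sum: "((\<lambda>(k, m). g (k + int m) * h m) has_sum (infsum g UNIV * (1 / qpoch (- (q / x)) q))) (UNIV \<times> UNIV)" .
  have inner: "((\<lambda>m. g (k + int m) * h m) has_sum (g k * qpoch (q powi (k + 1)) q)) UNIV" for k
  proof -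
    have eq: "g (k + int m) * h m = g k * (qbinc q (- 1) 0 m * (- (q powi (k + 1))) ^ m)" for m
    proof -
      \<comment> \<open>This splits the term into g(k) and a term of the Euler expansion at t =
        -q^(k+1); the powers of x coming from the shift and from \<open>h\<close> cancel.\<close>
      have "int (tri (k + int m)) + int m = int (tri k) + int (m choose 2) + (k + 1) * int m"
        using two_tri[of k] two_tri[of "k + int m"] two_tri[of "int m"]
        by (simp add: tri_of_nat algebra_simps)
      then have "q powi (int (tri (k + int m)) + int m) = q powi (int (tri k) + int (m choose 2) + (k + 1) * int m)"
        by simp
      then have *: "q ^ tri (k + int m) * q ^ m = q ^ tri k * q ^ (m choose 2) * (q powi (k + 1)) ^ m"
        using q(2) by (simp add: power_int_add power_int_mult)
      have "g (k + int m) * h m = (q ^ tri (k + int m) * q ^ m) * x powi k * (- 1) ^ m / D m"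
        unfolding g_def h_def qbinc_one D_def
        using x0 by (simp add: power_int_add power_divide power_minus[of "q / x"])
      also have "\<dots> = g k * (qbinc q (- 1) 0 m * (- (q powi (k + 1))) ^ m)"
        unfolding * g_def qbinc_zero D_def power_minus[of "q powi (k + 1)"] by (simp add: mult_ac)
      finally show ?thesis .
    qed
    show ?thesis unfolding eq
    proof (intro has_sum_cmult_right sums_imp_has_sum)
      show "summable (\<lambda>m. norm (qbinc q (- 1) 0 m * (- (q powi (k + 1))) ^ m))"
        by (rule qbinc_summable) (use q in auto)
      show "(\<lambda>m. qbinc q (- 1) 0 m * (- (q powi (k + 1))) ^ m) sums qpoch (q powi (k + 1)) q"
        using q_binomial[of q 0 "- (q powi (k + 1))" "- 1"] q by simp
    qed
  qed
  have "((\<lambda>k. g k * qpoch (q powi (k + 1)) q) has_sum (infsum g UNIV * (1 / qpoch (- (q / x)) q))) UNIV"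
    by (rule has_sum_SigmaD[OF prod_sum]) (simp add: inner)
  moreover have "((\<lambda>k. g k * qpoch (q powi (k + 1)) q) has_sum (qpoch (- x) q * qpoch q q)) UNIV"
  proof -
    \<comment> \<open>The exponent k + 1 is at most 0, so the factor with index i = -k - 1 is 1 - 1
      = 0.\<close>
    have neg: "qpoch (q powi (k + 1)) q = 0" if "k < 0" for k
    proof -
      have "qpoch (q powi (k + 1)) q = (\<Prod>i<Suc (nat (- k - 1)). 1 - q ^ i * q powi (k + 1)) * qpoch (q ^ Suc (nat (- k - 1)) * q powi (k + 1)) q"
        by (rule qpoch_split[OF q(1)])
      moreover have "q ^ nat (- k - 1) * q powi (k + 1) = 1"
      proof -
        have "q ^ nat (- k - 1) = q powi (- k - 1)" using that by (simp add: power_int_def)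
        also have "\<dots> * q powi (k + 1) = q powi ((- k - 1) + (k + 1))"
          by (rule power_int_add[symmetric]) (use q in auto)
        finally show ?thesis by simp
      qed
      ultimately show ?thesis by simp
    qed
    \<comment> \<open>The tail of (q) is (q) divided by its first n factors, and this denominator
      turns the theta term into a term of Euler's expansion of (-x).\<close>
    have pos: "g (int n) * qpoch (q powi (int n + 1)) q = qbinc q (- 1) 0 n * x ^ n * qpoch q q" for n
    proof -
      have "qpoch q q = (\<Prod>i<n. 1 - q ^ i * q) * qpoch (q ^ n * q) q"
        by (rule qpoch_split[OF q(1)])
      also have "(\<Prod>i<n. 1 - q ^ i * q) = D n" by (simp add: D_def mult.commute)
      also have "q ^ n * q = q powi (int n + 1)" using q by (simp add: power_int_add)
      finally have "qpoch q q = D n * qpoch (q powi (int n + 1)) q" .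
      moreover have "qbinc q (- 1) 0 n = q ^ (n choose 2) / D n"
        by (simp add: qbinc_zero D_def)
      ultimately show ?thesis using D0[of n]
        by (simp add: g_def tri_of_nat)
    qed
    have "((\<lambda>n. qbinc q (- 1) 0 n * x ^ n * qpoch q q) has_sum (qpoch (- x) q * qpoch q q)) UNIV"
    proof (intro has_sum_cmult_left sums_imp_has_sum)
      show "summable (\<lambda>m. norm (qbinc q (- 1) 0 m * x ^ m))"
        by (rule qbinc_summable) (use q in auto)
      show "(\<lambda>m. qbinc q (- 1) 0 m * x ^ m) sums qpoch (- x) q"
        using q_binomial[of q 0 x "- 1"] q by simp
    qed
    also have "?this \<longleftrightarrow> ((\<lambda>k. g k * qpoch (q powi (k + 1)) q) has_sum (qpoch (- x) q * qpoch q q)) {0..}"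
      by (rule has_sum_reindex_bij_witness[where j = int and i = nat]) (auto simp: pos)
    also have "\<dots> \<longleftrightarrow> ((\<lambda>k. g k * qpoch (q powi (k + 1)) q) has_sum (qpoch (- x) q * qpoch q q)) UNIV"
      by (rule has_sum_cong_neutral) (auto simp: neg)
    finally show ?thesis .
  qed
  ultimately have "infsum g UNIV * (1 / qpoch (- (q / x)) q) = qpoch (- x) q * qpoch q q"
    by (rule has_sum_unique)
  then have "infsum g UNIV = jtheta (- x) q"
    using qpoch_nonzero'[OF q(1) qx] by (simp add: jtheta_def field_simps)
  with Theta show ?thesis unfolding g_def by simp
qed

section \<open>Sums over multisets\<close>

text \<open>For a set S of positive integers these are the partitions with parts in S;
  \<open>msets {1..}\<close> consists of all partitions.\<close>

definition msets :: "'a set \<Rightarrow> 'a multiset set" where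
  "msets S = {P. set_mset P \<subseteq> S}"

lemma has_sum_geometric:
  assumes "norm (w::complex) < 1"
  shows "((\<lambda>k. w ^ k) has_sum (1 / (1 - w))) UNIV"
  by (intro sums_imp_has_sum geometric_sums) (use assms in \<open>auto simp: norm_power summable_geometric\<close>)

text \<open>Splitting off the multiplicity of one element contributes a geometric series. Absolute
  summability is carried through the induction because the product rule for sums requires
  it.\<close>

lemma has_sum_msets_finite:
  fixes w :: "'a \<Rightarrow> complex"
  assumes "finite S" "\<And>x. x \<in> S \<Longrightarrow> norm (w x) < 1"
  shows "(\<lambda>P. norm (\<Prod>x\<in>#P. w x)) summable_on msets S
    \<and> ((\<lambda>P. \<Prod>x\<in>#P. w x) has_sum (\<Prod>x\<in>S. 1 / (1 - w x))) (msets S)"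
  using assms
proof (induction S rule: finite_induct)
  case empty
  have "msets {} = {{#} :: 'a multiset}" by (auto simp: msets_def)
  then show ?case by (simp add: has_sum_finite_iff)
next
  case (insert a S)
  let ?j = "\<lambda>(k, P). replicate_mset k a + P" and ?i = "\<lambda>Q. (count Q a, filter_mset (\<lambda>x. x \<noteq> a) Q)"
  have wa: "norm (w a) < 1" using insert by auto
  have IH: "(\<lambda>P. norm (\<Prod>x\<in>#P. w x)) summable_on msets S"
    "((\<lambda>P. \<Prod>x\<in>#P. w x) has_sum (\<Prod>x\<in>S. 1 / (1 - w x))) (msets S)"
    using insert by auto
  have geo: "(\<lambda>k. norm (w a ^ k)) summable_on UNIV"
    by (intro abs_summable_on_UNIV_nat) (use wa in \<open>simp add: norm_power summable_geometric\<close>)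
  have bij: "?i z \<in> UNIV \<times> msets S" "?j (?i z) = z" if "z \<in> msets (insert a S)" for z
  proof -
    show "?i z \<in> UNIV \<times> msets S" using that by (auto simp: msets_def)
    have "replicate_mset (count z a) a + filter_mset (\<lambda>x. \<not> x = a) z
        = filter_mset (\<lambda>x. x = a) z + filter_mset (\<lambda>x. \<not> x = a) z"
      by (simp only: filter_eq_replicate_mset)
    also have "\<dots> = z" by (rule multiset_partition[symmetric])
    finally show "?j (?i z) = z" by simp
  qed
  have bij': "?j p \<in> msets (insert a S)" "?i (?j p) = p" if "p \<in> UNIV \<times> msets S" for p
  proof -
    obtain k P where p: "p = (k, P)" by (cases p)
    with that have P: "set_mset P \<subseteq> S" by (simp add: msets_def)
    have "a \<notin># P" using P insert.hyps by auto
    then have "filter_mset (\<lambda>x. x \<noteq> a) P = P" 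
      by (intro multiset_eqI) (auto simp: not_in_iff)
    moreover have "set_mset (replicate_mset k a) \<subseteq> {a}" by (simp add: set_mset_replicate_mset_subset)
    moreover have "filter_mset (\<lambda>x. x \<noteq> a) (replicate_mset k a) = {#}"
      by (intro multiset_eqI) auto
    moreover have "count P a = 0" using \<open>a \<notin># P\<close> by (simp add: not_in_iff)
    ultimately have 1: "(count (replicate_mset k a + P) a, filter_mset (\<lambda>x. x \<noteq> a) (replicate_mset k a + P)) = (k, P)"
      by simp
    have 2: "replicate_mset k a + P \<in> msets (insert a S)"
      using P \<open>set_mset (replicate_mset k a) \<subseteq> {a}\<close> unfolding msets_def by auto
    show "?j p \<in> msets (insert a S)" "?i (?j p) = p"
      unfolding p prod.case by (fact 2, fact 1)
  qed
  have "(\<lambda>z. norm (case z of (k, P) \<Rightarrow> w a ^ k * (\<Prod>x\<in>#P. w x))) summable_on UNIV \<times> msets S"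
    by (intro abs_summable_on_Times_mult geo IH)
  also have "?this \<longleftrightarrow> (\<lambda>P. norm (\<Prod>x\<in>#P. w x)) summable_on msets (insert a S)"
    by (rule summable_on_reindex_bij_witness[where j = ?j and i = ?i])
       (erule bij bij' | auto simp: norm_mult norm_power)+
  finally have 1: "(\<lambda>P. norm (\<Prod>x\<in>#P. w x)) summable_on msets (insert a S)" .
  have "((\<lambda>(k, P). w a ^ k * (\<Prod>x\<in>#P. w x)) has_sum (1 / (1 - w a) * (\<Prod>x\<in>S. 1 / (1 - w x)))) (UNIV \<times> msets S)"
    by (intro has_sum_Times_mult geo IH has_sum_geometric wa)
  also have "?this \<longleftrightarrow> ((\<lambda>P. \<Prod>x\<in>#P. w x) has_sum (1 / (1 - w a) * (\<Prod>x\<in>S. 1 / (1 - w x)))) (msets (insert a S))"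
    by (rule has_sum_reindex_bij_witness[where j = ?j and i = ?i])
       (erule bij bij' | auto)+
  finally show ?case using 1 by (simp only: prod.insert[OF insert.hyps] simp_thms)
qed

text \<open>A finite set that nearly exhausts the sum already lies in some B N. For n beyond N, all
  finite subsets of B n containing it have sums close to s, and so does their limit t n.\<close>

lemma has_sum_increasing_limit:
  fixes f :: "'a \<Rightarrow> complex"
  assumes "(f has_sum s) A" "\<And>N. (f has_sum t N) (B N)"
    and "mono B" "A = (\<Union>N::nat. B N)"
  shows "t \<longlonglongrightarrow> s"
proof (rule LIMSEQ_I)
  fix e :: real assume "0 < e"
  \<comment> \<open>Half of e, since the limit over finite subsets preserves only a weak
    inequality.\<close>
  then have e: "0 < e / 2" by simp
  obtain F where F: "finite F" "F \<subseteq> A" "\<And>G. finite G \<Longrightarrow> F \<subseteq> G \<Longrightarrow> G \<subseteq> A \<Longrightarrow> dist (sum f G) s < e / 2"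
    using tendstoD[OF assms(1)[unfolded has_sum_def] e] unfolding eventually_finite_subsets_at_top by metis
  have "\<exists>N. F \<subseteq> B N"
    using F(1,2)
  proof (induction F rule: finite_induct)
    case (insert x F)
    then obtain N M where "F \<subseteq> B N" "x \<in> B M" using assms(4) by auto
    then have "insert x F \<subseteq> B (max N M)"
      using monoD[OF assms(3), of N "max N M"] monoD[OF assms(3), of M "max N M"] by auto
    then show ?case by blast
  qed auto
  then obtain N where N: "F \<subseteq> B N" by blast
  have "norm (t n - s) \<le> e / 2" if "n \<ge> N" for n
  proof (rule tendsto_upperbound)
    show "((\<lambda>G. norm (sum f G - s)) \<longlongrightarrow> norm (t n - s)) (finite_subsets_at_top (B n))"
      by (intro tendsto_intros assms(2)[unfolded has_sum_def])
    have "F \<subseteq> B n" using N monoD[OF assms(3) that] by auto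
    moreover have "B n \<subseteq> A" using assms(4) by auto
    ultimately show "\<forall>\<^sub>F G in finite_subsets_at_top (B n). norm (sum f G - s) \<le> e / 2"
      unfolding eventually_finite_subsets_at_top
      by (intro exI[of _ F]) (use F in \<open>force simp: dist_norm intro: less_imp_le\<close>)
  qed auto
  moreover have "e / 2 < e" using \<open>0 < e\<close> by simp
  ultimately show "\<exists>no. \<forall>n\<ge>no. norm (t n - s) < e"
    by (meson le_less_trans)
qed

text \<open>Bounds a product of geometric series by the exponential of a sum, uniformly in the
  number of factors.\<close>

lemma inverse_one_minus_le_exp:
  fixes u r :: real
  assumes "0 \<le> u" "u \<le> r" "r < 1"
  shows "1 / (1 - u) \<le> exp (u / (1 - r))"
proof -
  have "1 / (1 - u) = 1 + u / (1 - u)" using assms by (simp add: field_simps)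
  also have "u / (1 - u) \<le> u / (1 - r)" using assms by (intro divide_left_mono) auto
  also have "1 + u / (1 - r) \<le> exp (u / (1 - r))" by (rule exp_ge_add_one_self)
  finally show ?thesis by simp
qed

lemma norm_le_of_le_power:
  fixes w :: "nat \<Rightarrow> complex" and r :: real
  assumes "0 \<notin> S" "0 \<le> r" "r < 1" "\<And>x. x \<in> S \<Longrightarrow> norm (w x) \<le> r ^ x" "x \<in> S"
  shows "norm (w x) \<le> r"
proof -
  have "x \<noteq> 0" using assms(1,5) by metis
  then have "r ^ x \<le> r ^ 1" using assms(2,3) by (intro power_decreasing) auto
  with assms(4)[OF assms(5)] show ?thesis by simp
qed

text \<open>A finite set of multisets involves only a finite set T of parts. The sum of norms over
  \<open>msets T\<close> is again a product of geometric series, at most the exponential of the sum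
  of r^x / (1 - r), hence at most exp (1 / (1 - r)^2) independently of T.\<close>

lemma abs_summable_msets:
  fixes w :: "nat \<Rightarrow> complex"
  assumes "0 \<notin> S" "0 \<le> r" "r < 1" "\<And>x. x \<in> S \<Longrightarrow> norm (w x) \<le> r ^ x"
  shows "(\<lambda>P. norm (\<Prod>x\<in>#P. w x)) summable_on msets S"
proof (rule nonneg_bdd_above_summable_on)
  have le: "norm (w x) \<le> r" if "x \<in> S" for x
    by (rule norm_le_of_le_power[OF assms that])
  have "(\<Sum>P\<in>F. norm (\<Prod>x\<in>#P. w x)) \<le> exp (1 / (1 - r) / (1 - r))"
    if F: "finite F" "F \<subseteq> msets S" for F
  proof -
    have "finite (\<Union>P\<in>F. set_mset P)" using F(1) by simp
    then obtain N where N: "(\<Union>P\<in>F. set_mset P) \<subseteq> {..N}"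
      unfolding finite_nat_iff_bounded_le by blast
    define T where "T = S \<inter> {..N}"
    have T: "finite T" "F \<subseteq> msets T" "T \<subseteq> S"
      using F N unfolding T_def msets_def by blast+
    \<comment> \<open>The complex statement is applied to the weights \<open>norm (w x)\<close> and
      then read back over the reals.\<close>
    have "((\<lambda>P. \<Prod>x\<in>#P. complex_of_real (norm (w x))) has_sum (\<Prod>x\<in>T. 1 / (1 - complex_of_real (norm (w x))))) (msets T)"
    proof (intro has_sum_msets_finite[THEN conjunct2] T(1))
      fix x assume "x \<in> T"
      then have "norm (w x) \<le> r" using T(3) by (intro le) auto
      then show "norm (complex_of_real (norm (w x))) < 1" using assms(3) by simp
    qed
    moreover have "(\<Prod>x\<in>#P. complex_of_real (norm (w x))) = complex_of_real (norm (\<Prod>x\<in>#P. w x))" for P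
      by (induction P) (auto simp: norm_mult)
    moreover have "(\<Prod>x\<in>T. 1 / (1 - complex_of_real (norm (w x)))) = complex_of_real (\<Prod>x\<in>T. 1 / (1 - norm (w x)))"
      by simp
    ultimately have hs: "((\<lambda>P. norm (\<Prod>x\<in>#P. w x)) has_sum (\<Prod>x\<in>T. 1 / (1 - norm (w x)))) (msets T)"
      by (simp only: has_sum_of_real_iff)
    have "(\<Sum>P\<in>F. norm (\<Prod>x\<in>#P. w x)) \<le> (\<Prod>x\<in>T. 1 / (1 - norm (w x)))"
      by (rule finite_sum_le_has_sum[OF hs]) (use F T in auto)
    also have "\<dots> \<le> (\<Prod>x\<in>T. exp (r ^ x / (1 - r)))"
    proof (rule prod_mono)
      fix x assume "x \<in> T"
      then have "x \<in> S" using T by auto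
      note x = le[OF this] assms(4)[OF this]
      have "1 / (1 - norm (w x)) \<le> exp (norm (w x) / (1 - r))"
        by (intro inverse_one_minus_le_exp x assms(3)) simp
      also have "\<dots> \<le> exp (r ^ x / (1 - r))"
        using x(2) assms(3) by (simp add: divide_right_mono)
      finally show "0 \<le> 1 / (1 - norm (w x)) \<and> 1 / (1 - norm (w x)) \<le> exp (r ^ x / (1 - r))"
        using x(1) assms(3) by simp
    qed
    also have "\<dots> = exp ((\<Sum>x\<in>T. r ^ x) / (1 - r))"
      using T by (simp add: exp_sum sum_divide_distrib)
    also have "\<dots> \<le> exp (1 / (1 - r) / (1 - r))"
    proof -
      have "(\<Sum>x\<in>T. r ^ x) \<le> (\<Sum>x. r ^ x)"
        using assms(2,3) by (intro sum_le_suminf summable_geometric T(1)) auto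
      also have "(\<Sum>x. r ^ x) = 1 / (1 - r)"
        using assms(2,3) by (intro suminf_geometric) simp
      finally have "(\<Sum>x\<in>T. r ^ x) / (1 - r) \<le> 1 / (1 - r) / (1 - r)"
        using assms(3) by (intro divide_right_mono) auto
      then show ?thesis by simp
    qed
    finally show ?thesis .
  qed
  then show "bdd_above (sum (\<lambda>P. norm (\<Prod>x\<in>#P. w x)) ` {F. F \<subseteq> msets S \<and> finite F})"
    by (intro bdd_aboveI2) auto
qed auto

text \<open>Absolute convergence guarantees that the sum exists; its value is then the limit of the
  finite products over parts at most N.\<close>

lemma has_sum_msets:
  fixes w :: "nat \<Rightarrow> complex"
  assumes "0 \<notin> S" "0 \<le> r" "r < 1" "\<And>x. x \<in> S \<Longrightarrow> norm (w x) \<le> r ^ x"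
    and "(\<lambda>N. \<Prod>x\<in>S \<inter> {..N}. 1 / (1 - w x)) \<longlonglongrightarrow> L"
  shows "((\<lambda>P. \<Prod>x\<in>#P. w x) has_sum L) (msets S)"
proof -
  have lt: "norm (w x) < 1" if "x \<in> S" for x
    using norm_le_of_le_power[OF assms(1-4) that] assms(3) by simp
  have "(\<lambda>P. \<Prod>x\<in>#P. w x) summable_on msets S"
    using abs_summable_msets[OF assms(1-4)] by (rule abs_summable_summable)
  then have hs: "((\<lambda>P. \<Prod>x\<in>#P. w x) has_sum infsum (\<lambda>P. \<Prod>x\<in>#P. w x) (msets S)) (msets S)"
    by simp
  have "(\<lambda>N. \<Prod>x\<in>S \<inter> {..N}. 1 / (1 - w x)) \<longlonglongrightarrow> infsum (\<lambda>P. \<Prod>x\<in>#P. w x) (msets S)"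
  proof (rule has_sum_increasing_limit[OF hs, where B = "\<lambda>N. msets (S \<inter> {..N})"])
    show "((\<lambda>P. \<Prod>x\<in>#P. w x) has_sum (\<Prod>x\<in>S \<inter> {..N}. 1 / (1 - w x))) (msets (S \<inter> {..N}))" for N
      using lt by (intro has_sum_msets_finite[THEN conjunct2]) auto
    show "mono (\<lambda>N. msets (S \<inter> {..N}))"
      by (rule monoI) (auto simp: msets_def)
    have "\<exists>N. set_mset P \<subseteq> {..N}" for P :: "nat multiset"
      using finite_nat_iff_bounded_le[of "set_mset P"] by simp
    then show "msets S = (\<Union>N. msets (S \<inter> {..N}))" by (auto simp: msets_def)
  qed
  then have "infsum (\<lambda>P. \<Prod>x\<in>#P. w x) (msets S) = L"
    using assms(5) LIMSEQ_unique by blast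
  with hs show ?thesis by simp
qed

text \<open>Used to classify partitions by largest part, by number of ones and by size, and integers
  by residue class.\<close>

lemma has_sum_fibers:
  fixes f :: "'a \<Rightarrow> complex"
  assumes "(f has_sum s) A" "\<And>b. b \<in> B \<Longrightarrow> (f has_sum g b) {x \<in> A. \<kappa> x = b}" "\<kappa> ` A \<subseteq> B"
  shows "(g has_sum s) B"
proof -
  have "(f has_sum s) A \<longleftrightarrow> ((\<lambda>(b, x). f x) has_sum s) (Sigma B (\<lambda>b. {x \<in> A. \<kappa> x = b}))"
    by (rule has_sum_reindex_bij_witness[where i = snd and j = "\<lambda>x. (\<kappa> x, x)"]) (use assms(3) in auto)
  then have "((\<lambda>(b, x). f x) has_sum s) (Sigma B (\<lambda>b. {x \<in> A. \<kappa> x = b}))"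
    using assms(1) by simp
  then show ?thesis
    by (rule has_sum_SigmaD) (use assms(2) in auto)
qed

section \<open>The crank generating function\<close>

lemma prod_mset_power: "(\<Prod>x\<in>#P. q ^ x) = q ^ sum_mset P" for q :: complex
  by (induction P) (auto simp: power_add)

lemma prod_mset_power_if:
  "(\<Prod>x\<in>#P. (if n < x then z else 1) * q ^ x) = z ^ size (filter_mset (\<lambda>x. n < x) P) * q ^ sum_mset P"
  for q z :: complex
  by (induction P) (auto simp: power_add)

lemma prod_one_minus_power:
  fixes q :: complex
  assumes "1 \<le> m"
  shows "(\<Prod>i<m. 1 - q ^ Suc i) = (1 - q) * (\<Prod>x\<in>{2..m}. 1 - q ^ x)"
  using assms
proof (induction m rule: nat_induct_at_least)
  case (Suc n)
  then have "{2..Suc n} = insert (Suc n) {2..n}" by auto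
  with Suc show ?case by (simp add: mult_ac del: power_Suc)
qed simp

lemma one_minus_unit_power_nonzero:
  fixes q z :: complex
  assumes "norm q < 1" "norm z = 1" "0 < n"
  shows "1 - z * q ^ n \<noteq> 0"
proof
  assume "1 - z * q ^ n = 0"
  then have "norm (z * q ^ n) = norm (1::complex)" by simp
  with assms norm_power_less_one[OF assms(1,3)] show False by (simp add: norm_mult)
qed

text \<open>Removing one copy of the largest part m, which is the crank, leaves an arbitrary
  partition with parts in 2, ..., m.\<close>

lemma has_sum_crank_no_ones:
  fixes q z :: complex
  assumes q: "norm q < 1" and m: "2 \<le> m"
  shows "((\<lambda>P. z powi crank P * q ^ sum_mset P) has_sum (z ^ m * q ^ m * (\<Prod>x\<in>{2..m}. 1 / (1 - q ^ x))))
     {P \<in> msets {1..} - {{#}}. count P 1 = 0 \<and> Max (set_mset P) = m}" (is "(?W has_sum ?s) ?A")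
proof -
  have "((\<lambda>P. \<Prod>x\<in>#P. q ^ x) has_sum (\<Prod>x\<in>{2..m}. 1 / (1 - q ^ x))) (msets {2..m})"
  proof (rule has_sum_msets_finite[THEN conjunct2])
    fix x :: nat assume "x \<in> {2..m}"
    then show "norm (q ^ x) < 1" using q by (intro norm_power_less_one) auto
  qed simp
  then have "((\<lambda>P. z ^ m * q ^ m * (\<Prod>x\<in>#P. q ^ x)) has_sum ?s) (msets {2..m})"
    by (rule has_sum_cmult_right)
  also have "?this \<longleftrightarrow> (?W has_sum ?s) ?A"
  proof (rule has_sum_reindex_bij_witness[where j = "add_mset m" and i = "\<lambda>Q. Q - {#m#}"])
    fix P assume "P \<in> msets {2..m}"
    then have P: "\<And>x. x \<in># P \<Longrightarrow> 2 \<le> x \<and> x \<le> m" by (auto simp: msets_def)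
    have max: "Max (set_mset (add_mset m P)) = m"
      by (rule Max_eqI) (use P in auto)
    have "count P 1 = 0" using P[of 1] by (auto simp: not_in_iff[symmetric])
    then have cnt: "count (add_mset m P) 1 = 0" using m by simp
    show "add_mset m P \<in> ?A"
      using max cnt P m by (force simp: msets_def)
    have "crank (add_mset m P) = int m"
      using max cnt unfolding crank_def by simp
    then show "?W (add_mset m P) = z ^ m * q ^ m * (\<Prod>x\<in>#P. q ^ x)"
      by (simp add: prod_mset_power power_add)
  next
    fix Q assume Q: "Q \<in> ?A"
    then have mem: "m \<in># Q" using Max_in[of "set_mset Q"] by auto
    then show "add_mset m (Q - {#m#}) = Q" by simp
    have "2 \<le> x \<and> x \<le> m" if "x \<in># Q" for x
    proof -
      have "1 \<le> x" using Q that by (auto simp: msets_def)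
      moreover have "x \<noteq> 1" using Q that by (auto simp: not_in_iff[symmetric])
      moreover have "x \<le> m" using Q that Max_ge[of "set_mset Q" x] by auto
      ultimately show ?thesis by simp
    qed
    then show "Q - {#m#} \<in> msets {2..m}"
      by (auto simp: msets_def dest!: in_diffD)
  qed simp_all
  finally show ?thesis .
qed

text \<open>Removing the n ones leaves an arbitrary partition with parts at least 2. Each part above
  n carries a factor z and the ones carry z^(-n), which together is z to the crank.\<close>

lemma has_sum_crank_ones:
  fixes q z :: complex
  assumes q: "norm q < 1" and z: "norm z = 1" and n: "1 \<le> n"
  shows "((\<lambda>P. z powi crank P * q ^ sum_mset P) has_sum
      (q ^ n / z ^ n * ((\<Prod>x\<in>{2..n}. 1 / (1 - q ^ x)) / qpoch (z * q ^ Suc n) q)))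
     {P \<in> msets {1..} - {{#}}. count P 1 = n}" (is "(?W has_sum ?s) ?A")
proof -
  define w where "w = (\<lambda>x. (if n < x then z else 1) * q ^ x)"
  define L where "L = (\<Prod>x\<in>{2..n}. 1 / (1 - q ^ x)) / qpoch (z * q ^ Suc n) q"
  have lim: "(\<lambda>N. \<Prod>x\<in>{2..} \<inter> {..N}. 1 / (1 - w x)) \<longlonglongrightarrow> L"
  \<comment> \<open>Starting at N = n completes the unweighted factors; every further part adds one
    factor of \<open>qpoch (z * q ^ Suc n) q\<close>.\<close>
  proof (rule LIMSEQ_offset)
    have "(\<Prod>x\<in>{2..} \<inter> {..k + n}. 1 / (1 - w x))
        = (\<Prod>x\<in>{2..n}. 1 / (1 - q ^ x)) / (\<Prod>i<k. 1 - q ^ i * (z * q ^ Suc n))" for k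
    proof (induction k)
      case 0
      have "{2..} \<inter> {..n} = {2..n}" by auto
      then show ?case by (simp add: w_def)
    next
      case (Suc k)
      have "{2..} \<inter> {..Suc k + n} = insert (Suc k + n) ({2..} \<inter> {..k + n})"
        using n by auto
      moreover have "w (Suc k + n) = q ^ k * (z * q ^ Suc n)"
        by (simp add: w_def power_add)
      ultimately show ?case using Suc by (simp add: prod.insert del: power_Suc)
    qed
    moreover have "(\<lambda>k. (\<Prod>x\<in>{2..n}. 1 / (1 - q ^ x)) / (\<Prod>i<k. 1 - q ^ i * (z * q ^ Suc n))) \<longlonglongrightarrow> L"
      unfolding L_def
    proof (intro tendsto_intros qpoch_LIMSEQ q qpoch_nonzero')
      show "norm (z * q ^ Suc n) < 1"
        using norm_power_less_one[OF q, of "Suc n"] z by (simp add: norm_mult del: power_Suc)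
    qed
    ultimately show "(\<lambda>k. \<Prod>x\<in>{2..} \<inter> {..k + n}. 1 / (1 - w x)) \<longlonglongrightarrow> L" by simp
  qed
  have "((\<lambda>P. \<Prod>x\<in>#P. w x) has_sum L) (msets {2..})"
    by (rule has_sum_msets[OF _ _ q _ lim]) (use z in \<open>auto simp: w_def norm_mult norm_power\<close>)
  then have "((\<lambda>P. q ^ n / z ^ n * (\<Prod>x\<in>#P. w x)) has_sum ?s) (msets {2..})"
    unfolding L_def by (rule has_sum_cmult_right)
  also have "?this \<longleftrightarrow> (?W has_sum ?s) ?A"
  proof (rule has_sum_reindex_bij_witness[where j = "\<lambda>P. replicate_mset n 1 + P" and i = "filter_mset (\<lambda>x. x \<noteq> 1)"])
    fix P :: "nat multiset" assume "P \<in> msets {2..}"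
    then have P: "\<And>x. x \<in># P \<Longrightarrow> 2 \<le> x" by (auto simp: msets_def)
    have cnt0: "count P 1 = 0" using P[of 1] by (auto simp: not_in_iff[symmetric])
    then have cnt: "count (replicate_mset n 1 + P) 1 = n" by simp
    show "filter_mset (\<lambda>x. x \<noteq> 1) (replicate_mset n 1 + P) = P"
      using cnt0 by (intro multiset_eqI) auto
    have "x \<ge> 1" if "x \<in># replicate_mset n 1 + P" for x
      using that P by (force simp: in_replicate_mset split: if_splits)
    then show "replicate_mset n 1 + P \<in> ?A"
      using cnt n by (auto simp: msets_def simp del: set_mset_union)
    have "filter_mset (\<lambda>x. n < x) (replicate_mset n 1 + P) = filter_mset (\<lambda>x. n < x) P"
      using n by (intro multiset_eqI) auto
    then have "crank (replicate_mset n 1 + P) = int (size (filter_mset (\<lambda>x. n < x) P)) - int n"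
      unfolding crank_def cnt using n by simp
    moreover have "z \<noteq> 0" using z by auto
    ultimately show "?W (replicate_mset n 1 + P) = q ^ n / z ^ n * (\<Prod>x\<in>#P. w x)"
      unfolding w_def prod_mset_power_if by (simp add: power_int_diff power_add)
  next
    fix Q assume Q: "Q \<in> ?A"
    show "replicate_mset n 1 + filter_mset (\<lambda>x. x \<noteq> 1) Q = Q"
      using Q by (intro multiset_eqI) auto
    show "filter_mset (\<lambda>x. x \<noteq> 1) Q \<in> msets {2..}"
      using Q by (force simp: msets_def)
  qed simp_all
  finally show ?thesis .
qed

text \<open>On the unit circle the crank does not affect the norm, so convergence reduces to that of
  the partition series in |q|.\<close>

lemma abs_summable_crank:
  fixes q z :: complex
  assumes q: "norm q < 1" and z: "norm z = 1"
  shows "(\<lambda>P. norm (z powi crank P * q ^ sum_mset P)) summable_on msets {1..}"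
proof -
  have "(\<lambda>P. norm (\<Prod>x\<in>#P. q ^ x)) summable_on msets {1..}"
    by (rule abs_summable_msets[of _ "norm q"]) (use q in \<open>auto simp: norm_power\<close>)
  also have "(\<lambda>P. norm (\<Prod>x\<in>#P. q ^ x)) = (\<lambda>P. norm (z powi crank P * q ^ sum_mset P))"
    using z by (simp add: fun_eq_iff prod_mset_power norm_mult norm_power_int)
  finally show ?thesis .
qed

text \<open>The summand \<open>- (1 - q) - z * q\<close> accounts for the empty partition and the partition \<open>{#1#}\<close>, where the
  coefficients of the product are not given by the crank.\<close>
lemma has_sum_crank:
  fixes q z :: complex
  assumes q: "norm q < 1" and z: "norm z = 1"
  shows "((\<lambda>P. z powi crank P * q ^ sum_mset P) has_sum
     (qpoch q q / (qpoch (z * q) q * qpoch (q / z) q) - (1 - q) - z * q)) (msets {1..} - {{#}})"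
proof -
  let ?W = "\<lambda>P. z powi crank P * q ^ sum_mset P" and ?A = "msets {1..} - {{#}} :: nat multiset set"
  define s where "s = infsum ?W ?A"
  define c where "c = (1 - q) / qpoch (z * q) q"
  define F where "F = qpoch q q / (qpoch (z * q) q * qpoch (q / z) q)"
  have z0: "z \<noteq> 0" using z by auto
  have zq: "norm (z * q) < 1" "norm (q / z) < 1" using q z by (auto simp: norm_mult norm_divide)
  have sm: "?W summable_on B" if "B \<subseteq> msets {1..}" for B
    by (rule abs_summable_summable[OF summable_on_subset_banach[OF abs_summable_crank[OF q z] that]])
  have s: "(?W has_sum s) ?A" unfolding s_def using sm by auto
  define K where "K = {P \<in> ?A. count P 1 = 0}"
  define g0 where "g0 = infsum ?W K"
  have g0: "(?W has_sum g0) K" unfolding g0_def by (rule has_sum_infsum, rule sm) (auto simp: K_def)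
  define h where "h = (\<lambda>m. z ^ m * q ^ m * (\<Prod>x\<in>{2..m}. 1 / (1 - q ^ x)))"
  have "(h has_sum g0) {2..}"
  proof (rule has_sum_fibers[OF g0, where \<kappa> = "\<lambda>P. Max (set_mset P)"])
    fix m :: nat assume "m \<in> {2..}"
    then have "2 \<le> m" by simp
    have "{P \<in> K. Max (set_mset P) = m} = {P \<in> ?A. count P 1 = 0 \<and> Max (set_mset P) = m}"
      by (auto simp: K_def)
    then show "(?W has_sum h m) {P \<in> K. Max (set_mset P) = m}"
      unfolding h_def using has_sum_crank_no_ones[OF q \<open>2 \<le> m\<close>, of z] by simp
  next
    have "2 \<le> Max (set_mset P)" if "P \<in> K" for P
    proof -
      have "Max (set_mset P) \<in># P" using that by (intro Max_in) (auto simp: K_def)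
      moreover have "1 \<le> x \<and> x \<noteq> 1" if "x \<in># P" for x
        using that \<open>P \<in> K\<close> by (auto simp: K_def msets_def not_in_iff[symmetric])
      ultimately show ?thesis by force
    qed
    then show "(\<lambda>P. Max (set_mset P)) ` K \<subseteq> {2..}" by auto
  qed
  also have "(h has_sum g0) {2..} \<longleftrightarrow> ((\<lambda>i. h (i + 2)) has_sum g0) UNIV"
    by (rule has_sum_reindex_bij_witness[where i = "\<lambda>i. i + 2" and j = "\<lambda>m. m - 2"])
       (auto simp del: add_2_eq_Suc')
  finally have hsums: "(\<lambda>i. h (i + 2)) sums g0" by (rule has_sum_imp_sums)
  \<comment> \<open>\<open>f\<close> is (1 - q) times the terms of Euler's series for 1/(zq), the
    factor 1 - q accounting for the missing part 1. The largest part is at least 2, so the terms 1 -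
    q and z * q at m = 0 and m = 1 must be subtracted.\<close>
  define f where "f = (\<lambda>m. (1 - q) * (qbinc q 0 1 m * (z * q) ^ m))"
  have hf: "h m = f m" if "1 \<le> m" for m
    using one_minus_power_nonzero[OF q, of 0] prod_one_minus_power[OF that, of q]
    by (simp add: h_def f_def qbinc_one prod_dividef power_mult_distrib)
  have "f sums c"
    unfolding c_def f_def using sums_mult[OF q_binomial[of q 1 "z * q" 0], of "1 - q"] q zq by simp
  then have "(\<lambda>i. f (i + 2)) sums (c - (\<Sum>i<2. f i))"
    by (rule sums_split_initial_segment)
  also have "(\<lambda>i. f (i + 2)) = (\<lambda>i. h (i + 2))"
    by (simp add: hf del: add_2_eq_Suc')
  also have "(\<Sum>i<2. f i) = f 0 + f 1"
    by (simp add: numeral_2_eq_2)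
  also have "f 0 = 1 - q" by (simp add: f_def)
  also have "f 1 = z * q" unfolding hf[of 1, OF order_refl, symmetric] by (simp add: h_def)
  finally have "(\<lambda>i. h (i + 2)) sums (c - ((1 - q) + z * q))" .
  with hsums have g0_eq: "g0 = c - ((1 - q) + z * q)" by (rule sums_unique2)
  define g where "g = (\<lambda>n. if n = 0 then g0 else
     q ^ n / z ^ n * ((\<Prod>x\<in>{2..n}. 1 / (1 - q ^ x)) / qpoch (z * q ^ Suc n) q))"
  have "(g has_sum s) UNIV"
  proof (rule has_sum_fibers[OF s, where \<kappa> = "\<lambda>P. count P 1"])
    fix n
    show "(?W has_sum g n) {P \<in> ?A. count P 1 = n}"
    proof (cases "n = 0")
      case True
      then show ?thesis using g0 by (simp add: g_def K_def)
    next
      case False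
      then show ?thesis using has_sum_crank_ones[OF q z, of n] by (simp add: g_def)
    qed
  qed auto
  then have "g sums s" by (rule has_sum_imp_sums)
  then have gs: "(\<lambda>n. g (Suc n)) sums (s - g0)"
    using sums_Suc_iff[of g "s - g0"] by (simp add: g_def)
  \<comment> \<open>For n >= 1 the sums are c times the q-binomial terms with a = z * q, b = 1, t =
    q/z. The missing zeroth term is c, which cancels the c in \<open>g0_eq\<close>.\<close>
  have gc: "g n = c * (qbinc q (z * q) 1 n * (q / z) ^ n)" if "1 \<le> n" for n
  proof -
    have "qpoch (z * q) q = (\<Prod>i<n. 1 - q ^ i * (z * q)) * qpoch (q ^ n * (z * q)) q"
      by (rule qpoch_split[OF q])
    moreover have "(\<Prod>i<n. 1 - q ^ i * (z * q)) \<noteq> 0"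
      using one_minus_unit_power_nonzero[OF q z, of "Suc _"] by (simp add: mult_ac)
    moreover have "qbinc q (z * q) 1 n = (\<Prod>i<n. 1 - q ^ i * (z * q)) / ((1 - q) * (\<Prod>x\<in>{2..n}. 1 - q ^ x))"
      using prod_one_minus_power[OF that, of q] by (simp add: qbinc_def prod_dividef mult_ac)
    ultimately show ?thesis
      using that one_minus_power_nonzero[OF q, of 0]
      by (simp add: g_def c_def prod_dividef power_divide mult_ac)
  qed
  \<comment> \<open>Here a * t = q^2, and (1 - q)(q^2) = (q) gives the numerator.\<close>
  have "qpoch q q = (1 - q) * qpoch (z * q * (q / z)) q"
    using qpoch_Suc[OF q, of q] z0 by simp
  then have "(\<lambda>n. c * (qbinc q (z * q) 1 n * (q / z) ^ n)) sums F"
    using sums_mult[OF q_binomial[of q 1 "q / z" "z * q"], of c] q zq by (simp add: c_def F_def)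
  then have "(\<lambda>n. c * (qbinc q (z * q) 1 (Suc n) * (q / z) ^ Suc n)) sums (F - c)"
    using sums_Suc_iff[of "\<lambda>n. c * (qbinc q (z * q) 1 n * (q / z) ^ n)" "F - c"] by simp
  then have "(\<lambda>n. g (Suc n)) sums (F - c)" by (simp add: gc)
  with gs have "s - g0 = F - c" by (rule sums_unique2)
  then have "s = F - c + g0" by (simp add: diff_eq_eq)
  then have "s = F - (1 - q) - z * q" unfolding g0_eq by simp
  with s show ?thesis unfolding F_def by simp
qed

section \<open>Crank deviations as root-of-unity filters\<close>

lemma size_le_sum_mset:
  fixes P :: "nat multiset"
  shows "\<forall>x\<in>#P. 0 < x \<Longrightarrow> size P \<le> sum_mset P"
  by (induction P) auto

lemma finite_partitions_of: "finite (partitions_of n)"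
proof (rule finite_subset)
  show "partitions_of n \<subseteq> mset ` {xs. set xs \<subseteq> {..n} \<and> length xs \<le> n}"
  proof
    fix P assume P: "P \<in> partitions_of n"
    obtain xs where xs: "mset xs = P" using ex_mset by blast
    have "x \<le> n" if "x \<in># P" for x
      using P that by (auto simp: partitions_of_def dest!: multi_member_split)
    have "length xs \<le> n"
      using P xs size_le_sum_mset[of P] by (auto simp: partitions_of_def)
    moreover have "set xs \<subseteq> {..n}"
      using \<open>\<And>x. x \<in># P \<Longrightarrow> x \<le> n\<close> xs[symmetric] by auto
    ultimately show "P \<in> mset ` {xs. set xs \<subseteq> {..n} \<and> length xs \<le> n}"
      using xs by blast
  qed
qed (simp add: finite_lists_length_le)

lemma partitions_of_eq: "partitions_of n = {P \<in> msets {1..}. sum_mset P = n}"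
  by (auto simp: partitions_of_def msets_def Suc_le_eq)

lemma sum_mset_eq_0_imp_empty:
  fixes P :: "nat multiset"
  assumes "\<forall>x\<in>#P. 0 < x" "sum_mset P = 0"
  shows "P = {#}"
  using size_le_sum_mset[OF assms(1)] assms(2) by simp

lemma partitions_of_0: "partitions_of 0 = {{#}}"
  unfolding partitions_of_def using sum_mset_eq_0_imp_empty by fastforce

lemma partitions_of_1: "partitions_of 1 = {{#1#}}"
proof -
  have "P = {#1#}" if P: "\<forall>x\<in>#P. 0 < x" "sum_mset P = 1" for P :: "nat multiset"
  proof -
    obtain x R where P': "P = add_mset x R"
      using P(2) by (cases P) auto
    with P have R: "x + sum_mset R = 1" "0 < x" "\<forall>x\<in>#R. 0 < x" by auto
    then have "x = 1" "sum_mset R = 0" by linarith+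
    with sum_mset_eq_0_imp_empty[OF R(3)] P' show ?thesis by simp
  qed
  then show ?thesis by (auto simp: partitions_of_def)
qed

definition crank_poly :: "complex \<Rightarrow> nat \<Rightarrow> complex" where
  "crank_poly z n = (\<Sum>\<^sub>\<infinity>m. of_int (crank_count m n) * z powi m)"

text \<open>The values -1, 0, 1 cover n = 0 and n = 1, where \<open>crank_count\<close> is
  prescribed and not counted by cranks.\<close>

definition crank_support :: "nat \<Rightarrow> int set" where
  "crank_support n = {-1, 0, 1} \<union> crank ` partitions_of n"

lemma finite_crank_support [simp]: "finite (crank_support n)"
  by (simp add: crank_support_def finite_partitions_of)

lemma crank_count_eq_0: "m \<notin> crank_support n \<Longrightarrow> crank_count m n = 0"
  by (auto simp: crank_count_def crank_support_def card_eq_0_iff)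

lemma infsum_finite_support:
  fixes f :: "'a \<Rightarrow> complex"
  assumes "finite S" "\<And>x. x \<in> A - S \<Longrightarrow> f x = 0"
  shows "infsum f A = sum f (S \<inter> A)"
proof -
  have "infsum f A = infsum f (S \<inter> A)"
    by (rule infsum_cong_neutral) (use assms in auto)
  then show ?thesis using assms(1) by simp
qed

lemma crank_poly_eq_sum: "crank_poly z n = (\<Sum>m\<in>crank_support n. of_int (crank_count m n) * z powi m)"
  unfolding crank_poly_def
  by (subst infsum_finite_support[where S = "crank_support n"]) (auto simp: crank_count_eq_0)

lemma crank_poly_0: "crank_poly z 0 = 1"
proof -
  have "crank_poly z 0 = (\<Sum>m\<in>{0}. of_int (crank_count m 0) * z powi m)"
    unfolding crank_poly_eq_sum
    by (rule sum.mono_neutral_right) (auto simp: crank_count_def crank_support_def finite_partitions_of)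
  then show ?thesis by (simp add: crank_count_def)
qed

lemma crank_poly_1: "crank_poly z 1 = z + 1 / z - 1"
proof -
  have "crank_poly z 1 = (\<Sum>m\<in>{-1, 0, 1}. of_int (crank_count m 1) * z powi m)"
    unfolding crank_poly_eq_sum
    by (rule sum.mono_neutral_right) (auto simp: crank_count_def crank_support_def finite_partitions_of)
  then show ?thesis by (simp add: crank_count_def power_int_minus field_simps)
qed

lemma crank_poly_ge_2:
  assumes "2 \<le> n"
  shows "crank_poly z n = (\<Sum>P\<in>partitions_of n. z powi crank P)"
proof -
  have "(\<Sum>P\<in>partitions_of n. z powi crank P)
      = (\<Sum>m\<in>crank_support n. \<Sum>P\<in>{P \<in> partitions_of n. crank P = m}. z powi crank P)"
    by (rule sum.group[symmetric]) (auto simp: finite_partitions_of crank_support_def)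
  also have "\<dots> = (\<Sum>m\<in>crank_support n. of_int (crank_count m n) * z powi m)"
    by (rule sum.cong) (use assms in \<open>auto simp: crank_count_def\<close>)
  finally show ?thesis by (simp add: crank_poly_eq_sum)
qed

text \<open>The prescribed values at n = 1 also fit: 1 + 1 - 1 = 1 = p(1).\<close>

lemma crank_poly_one: "crank_poly 1 n = of_nat (npart n)"
proof -
  consider "n = 0" | "n = 1" | "2 \<le> n" by linarith
  then show ?thesis
  proof cases
    case 3
    then show ?thesis by (simp add: crank_poly_ge_2 npart_def)
  qed (simp_all add: crank_poly_0 crank_poly_1[simplified] npart_def partitions_of_0 partitions_of_1[simplified])
qed

lemma crank_generating_function:
  fixes q z :: complex
  assumes q: "norm q < 1" and z: "norm z = 1"
  shows "(\<lambda>n. crank_poly z n * q ^ n) sums (qpoch q q / (qpoch (z * q) q * qpoch (q / z) q))"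
proof -
  let ?F = "qpoch q q / (qpoch (z * q) q * qpoch (q / z) q)"
  let ?W = "\<lambda>P. z powi crank P * q ^ sum_mset P"
  define g where "g = (\<lambda>n. \<Sum>P\<in>partitions_of n - {{#}}. ?W P)"
  have "(g has_sum (?F - (1 - q) - z * q)) UNIV"
  proof (rule has_sum_fibers[OF has_sum_crank[OF q z], where \<kappa> = sum_mset])
    fix n
    have "{P \<in> msets {1..} - {{#}}. sum_mset P = n} = partitions_of n - {{#}}"
      by (auto simp: partitions_of_eq)
    then show "(?W has_sum g n) {P \<in> msets {1..} - {{#}}. sum_mset P = n}"
      unfolding g_def by (intro has_sum_finiteI) (simp_all add: finite_partitions_of)
  qed auto
  then have g: "g sums (?F - (1 - q) - z * q)" by (rule has_sum_imp_sums)
  have g0: "g 0 = 0" by (simp add: g_def partitions_of_0)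
  have g1: "g 1 = q / z"
  proof -
    have "crank {#1#} = - 1" by (simp add: crank_def)
    then show ?thesis unfolding g_def partitions_of_1 by (simp add: power_int_minus field_simps)
  qed
  have g2: "g n = crank_poly z n * q ^ n" if "2 \<le> n" for n
  proof -
    have "partitions_of n - {{#}} = partitions_of n"
      using that by (auto simp: partitions_of_def)
    moreover have "?W P = z powi crank P * q ^ n" if "P \<in> partitions_of n" for P
      using that by (simp add: partitions_of_def)
    ultimately show ?thesis
      unfolding g_def crank_poly_ge_2[OF that] sum_distrib_right by (intro sum.cong) auto
  qed
  \<comment> \<open>The correction is 1 at n = 0. At n = 1 it is (z + 1/z - 1) q - q/z = (z - 1) q,
    because the partition 1 has crank -1. Together they cancel - (1 - q) - z * q.\<close>
  have "(\<lambda>n. g n + (if n \<in> {0, 1} then (if n = 0 then 1 else (z - 1) * q) else 0)) sums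
     (?F - (1 - q) - z * q + (\<Sum>n\<in>{0, 1::nat}. if n = 0 then 1 else (z - 1) * q))"
    by (intro sums_add g sums_If_finite_set) simp
  also have "(\<lambda>n. g n + (if n \<in> {0, 1} then (if n = 0 then 1 else (z - 1) * q) else 0)) = (\<lambda>n. crank_poly z n * q ^ n)"
  proof
    fix n :: nat
    consider "n = 0" | "n = 1" | "2 \<le> n" by linarith
    then show "g n + (if n \<in> {0, 1} then (if n = 0 then 1 else (z - 1) * q) else 0) = crank_poly z n * q ^ n"
    proof cases
      case 2
      have "g 1 + (z - 1) * q = crank_poly z 1 * q" unfolding g1 crank_poly_1 by (simp add: algebra_simps)
      with 2 show ?thesis by simp
    qed (simp_all add: g0 g2 crank_poly_0)
  qed
  also have "?F - (1 - q) - z * q + (\<Sum>n\<in>{0, 1::nat}. if n = 0 then 1 else (z - 1) * q) = ?F"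
    by (simp add: algebra_simps)
  finally show ?thesis .
qed

text \<open>The hypothesis on \<omega> says that it is a primitive M-th root of unity; orthogonality
  is then a geometric sum with ratio \<omega>^k.\<close>

lemma sum_root_of_unity:
  fixes \<omega> :: complex
  assumes M: "0 < M" and \<omega>: "\<And>k. \<omega> powi k = 1 \<longleftrightarrow> int M dvd k"
  shows "(\<Sum>j<M. (\<omega> ^ j) powi k) = (if int M dvd k then of_nat M else 0)"
proof -
  have "\<omega> \<noteq> 0"
  proof
    assume "\<omega> = 0"
    with \<omega>[of "int M"] M show False by (simp add: power_0_left)
  qed
  have eq: "(\<omega> ^ j) powi k = (\<omega> powi k) ^ j" for j
    by (simp flip: power_int_of_nat power_int_mult add: mult.commute)
  show ?thesis
  proof (cases "int M dvd k")
    case True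
    then have "\<omega> powi k = 1" using \<omega> by blast
    with True show ?thesis by (simp add: eq)
  next
    case False
    then have "\<omega> powi k \<noteq> 1" using \<omega> by blast
    moreover have "(\<omega> powi k) ^ M = 1"
      using \<omega>[of "k * int M"] by (simp add: power_int_mult)
    ultimately show ?thesis using False sum_gp_strict[of "\<omega> powi k" M] by (simp add: eq)
  qed
qed

lemma crank_res_filter:
  fixes \<omega> :: complex
  assumes M: "0 < M" and \<omega>: "\<And>k. \<omega> powi k = 1 \<longleftrightarrow> int M dvd k"
  shows "crank_res a M n = (\<Sum>j<M. crank_poly (\<omega> ^ j) n * (\<omega> ^ j) powi (- a)) / of_nat M"
proof -
  let ?c = "\<lambda>m. of_int (crank_count m n) :: complex"
  have \<omega>0: "\<omega> \<noteq> 0"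
  proof
    assume "\<omega> = 0"
    with \<omega>[of "int M"] M show False by (simp add: power_0_left)
  qed
  have "(\<Sum>j<M. crank_poly (\<omega> ^ j) n * (\<omega> ^ j) powi (- a))
      = (\<Sum>j<M. \<Sum>m\<in>crank_support n. ?c m * (\<omega> ^ j) powi (m - a))"
    unfolding crank_poly_eq_sum sum_distrib_right
    by (intro sum.cong) (simp_all add: \<omega>0 power_int_diff power_int_minus field_simps)
  also have "\<dots> = (\<Sum>m\<in>crank_support n. ?c m * (\<Sum>j<M. (\<omega> ^ j) powi (m - a)))"
    unfolding sum_distrib_left by (rule sum.swap)
  also have "\<dots> = (\<Sum>m\<in>crank_support n. if int M dvd m - a then ?c m * of_nat M else 0)"
    unfolding sum_root_of_unity[OF assms] by (rule sum.cong) auto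
  also have "\<dots> = (\<Sum>m\<in>{m \<in> crank_support n. int M dvd m - a}. ?c m * of_nat M)"
    by (rule sum.inter_filter[symmetric]) simp
  also have "\<dots> = (\<Sum>m\<in>{m \<in> crank_support n. int M dvd m - a}. ?c m) * of_nat M"
    by (rule sum_distrib_right[symmetric])
  also have "(\<Sum>m\<in>{m \<in> crank_support n. int M dvd m - a}. ?c m) = crank_res a M n"
    unfolding crank_res_def
    by (subst infsum_finite_support[where S = "crank_support n"])
       (auto simp: crank_count_eq_0 mod_eq_dvd_iff intro!: sum.cong)
  finally show ?thesis using M by simp
qed

text \<open>The term j = 0 of the filter is p(n)/M, exactly what the deviation subtracts.\<close>

lemma crank_dev_filter:
  fixes \<omega> q :: complex
  assumes M: "0 < M" and \<omega>: "\<And>k. \<omega> powi k = 1 \<longleftrightarrow> int M dvd k" and q: "norm q < 1"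
  shows "crank_dev a M q = (\<Sum>j\<in>{1..<M}. qpoch q q / (qpoch (\<omega> ^ j * q) q * qpoch (q / \<omega> ^ j) q)
     * (\<omega> ^ j) powi (- a)) / of_nat M"
proof -
  let ?F = "\<lambda>z. qpoch q q / (qpoch (z * q) q * qpoch (q / z) q)"
  have "norm \<omega> ^ M = 1"
    using \<omega>[of "int M"] by (simp flip: norm_power)
  then have norm1: "norm \<omega> = 1"
    using M by (metis norm_ge_zero power_eq_1_iff abs_of_nonneg real_norm_def zero_less_iff_neq_zero)
  have "(\<lambda>n. (\<Sum>j\<in>{1..<M}. crank_poly (\<omega> ^ j) n * q ^ n * (\<omega> ^ j) powi (- a)) / of_nat M) sums
     ((\<Sum>j\<in>{1..<M}. ?F (\<omega> ^ j) * (\<omega> ^ j) powi (- a)) / of_nat M)"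
    by (intro sums_divide sums_sum sums_mult2 crank_generating_function q)
       (simp add: norm_power norm1)
  moreover have "(\<Sum>j\<in>{1..<M}. crank_poly (\<omega> ^ j) n * q ^ n * (\<omega> ^ j) powi (- a)) / of_nat M
     = (crank_res a M n - of_nat (npart n) / of_nat M) * q ^ n" for n
  proof -
    have "{..<M} = insert 0 {1..<M}" using M by auto
    then have "crank_res a M n = (of_nat (npart n) + (\<Sum>j\<in>{1..<M}. crank_poly (\<omega> ^ j) n * (\<omega> ^ j) powi (- a))) / of_nat M"
      unfolding crank_res_filter[OF M \<omega>] by (simp add: crank_poly_one)
    then have "(crank_res a M n - of_nat (npart n) / of_nat M) * q ^ n
       = (\<Sum>j\<in>{1..<M}. crank_poly (\<omega> ^ j) n * (\<omega> ^ j) powi (- a)) * q ^ n / of_nat M"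
      by (simp add: add_divide_distrib)
    also have "(\<Sum>j\<in>{1..<M}. crank_poly (\<omega> ^ j) n * (\<omega> ^ j) powi (- a)) * q ^ n
       = (\<Sum>j\<in>{1..<M}. crank_poly (\<omega> ^ j) n * q ^ n * (\<omega> ^ j) powi (- a))"
      unfolding sum_distrib_right by (rule sum.cong) (simp_all add: mult_ac)
    finally show ?thesis by simp
  qed
  ultimately show ?thesis
    unfolding crank_dev_def by (simp add: sums_iff)
qed

section \<open>Theta function dissections\<close>

text \<open>The window of representatives may start at any c: the exponents of the resulting theta
  series depend on the chosen representatives and must fall in the range of
  \<open>Jbar_has_sum\<close>.\<close>

lemma has_sum_residues:
  fixes f :: "int \<Rightarrow> complex"
  assumes M: "0 < M" and s: "(f has_sum s) UNIV"
    and g: "\<And>r. r \<in> {c..<c + M} \<Longrightarrow> ((\<lambda>k. f (M * k + r)) has_sum g r) UNIV"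
  shows "s = (\<Sum>r\<in>{c..<c + M}. g r)"
proof -
  have "(g has_sum s) {c..<c + M}"
  proof (rule has_sum_fibers[OF s, where \<kappa> = "\<lambda>n. (n - c) mod M + c"])
    fix r assume r: "r \<in> {c..<c + M}"
    have "(f has_sum g r) {n \<in> UNIV. (n - c) mod M + c = r} \<longleftrightarrow> ((\<lambda>k. f (M * k + r)) has_sum g r) UNIV"
    proof (rule has_sum_reindex_bij_witness[where i = "\<lambda>k. M * k + r" and j = "\<lambda>n. (n - r) div M"])
      fix n assume "n \<in> {n \<in> UNIV. (n - c) mod M + c = r}"
      then have "n - r = n - c - (n - c) mod M" by auto
      then have "n - r = M * ((n - c) div M)" by (simp only: minus_mod_eq_mult_div)
      then show eq: "M * ((n - r) div M) + r = n" using M by simp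
      then show "f (M * ((n - r) div M) + r) = f n" by simp
    next
      fix k :: int
      have "(M * k + r - c) mod M = (r - c) mod M" 
        by (metis add_diff_eq mod_mult_self4)
      also have "\<dots> = r - c" using r by (intro mod_pos_pos_trivial) auto
      finally show "M * k + r \<in> {n \<in> UNIV. (n - c) mod M + c = r}" by simp
      show "(M * k + r - r) div M = k" using M by simp
    qed simp_all
    with g[OF r] show "(f has_sum g r) {n \<in> UNIV. (n - c) mod M + c = r}" by simp
  next
    have "(n - c) mod M + c \<in> {c..<c + M}" for n
      using M pos_mod_bound[of M "n - c"] pos_mod_sign[of M "n - c"] by auto
    then show "(\<lambda>n. (n - c) mod M + c) ` UNIV \<subseteq> {c..<c + M}" by blast
  qed
  then show ?thesis by (simp add: has_sum_finite_iff)
qed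

text \<open>The triple product in base q^m at x = q^a; a < m is its condition that the base be
  smaller in norm than x.\<close>

lemma Jbar_has_sum:
  assumes q: "0 < norm q" "norm q < 1" and am: "a < m"
  shows "((\<lambda>k. q powi (int m * int (tri k) + int a * k)) has_sum Jbar a m q) UNIV"
proof -
  have q0: "q \<noteq> 0" using q by auto
  have "norm q ^ m < norm q ^ a" using q am by (intro power_strict_decreasing) auto
  then have "((\<lambda>k. (q ^ m) ^ tri k * (q ^ a) powi k) has_sum jtheta (- (q ^ a)) (q ^ m)) UNIV"
    using q0 am q by (intro jacobi_triple_product norm_power_less_one) (auto simp: norm_power)
  also have "(\<lambda>k. (q ^ m) ^ tri k * (q ^ a) powi k) = (\<lambda>k. q powi (int m * int (tri k) + int a * k))"
    using q0 by (simp add: fun_eq_iff power_int_add power_int_mult)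
  finally show ?thesis by (simp add: Jbar_def)
qed

lemma Jbar_reflect:
  assumes "q \<noteq> 0" "a \<le> m"
  shows "Jbar (m - a) m q = Jbar a m q"
proof -
  have "q ^ m / - (q ^ a) = - (q ^ (m - a))" "q ^ m / - (q ^ (m - a)) = - (q ^ a)"
    using assms by (simp_all add: power_diff)
  then show ?thesis unfolding Jbar_def jtheta_def by (simp add: mult_ac)
qed

text \<open>The residues run over \<open>- 3, ..., 4\<close> so that the exponents \<open>28 + 8 r\<close> stay strictly between 0 and 64,
  within the range of the triple product identity in base \<open>q^64\<close>.\<close>
lemma jtheta_dissect_8:
  assumes q: "0 < norm q" "norm q < 1" and z: "z ^ 8 = 1"
  shows "jtheta (- z) q = (1 + z) * Jbar 28 64 q + (z ^ 2 + z powi (- 1)) * (q * Jbar 20 64 q)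
     + (z ^ 3 + z powi (- 2)) * (q ^ 3 * Jbar 52 64 q) + (z ^ 4 + z powi (- 3)) * (q ^ 6 * Jbar 60 64 q)"
proof -
  have q0: "q \<noteq> 0" and z0: "z \<noteq> 0" using q z by auto
  have "norm z = 1" using power_eq_1_iff[OF z] by simp
  then have "((\<lambda>k. q ^ tri k * z powi k) has_sum jtheta (- z) q) UNIV"
    using q by (intro jacobi_triple_product) auto
  then have "jtheta (- z) q = (\<Sum>r\<in>{- 3..<- 3 + 8}. z powi r * q ^ tri r * Jbar (nat (28 + 8 * r)) 64 q)"
  proof (rule has_sum_residues[rotated])
    fix r :: int assume r: "r \<in> {- 3..<- 3 + 8}"
    have "q ^ tri (8 * k + r) * z powi (8 * k + r)
        = z powi r * q ^ tri r * q powi (int 64 * int (tri k) + int (nat (28 + 8 * r)) * k)" for k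
    proof -
      have "z powi (8 * k + r) = z powi r"
        using z0 z by (simp add: power_int_add power_int_mult)
      moreover have "int (tri (8 * k + r)) = int (tri r) + (int 64 * int (tri k) + int (nat (28 + 8 * r)) * k)"
        using r two_tri[of k] two_tri[of r] two_tri[of "8 * k + r"] by (simp add: algebra_simps)
      then have "q powi int (tri (8 * k + r)) = q powi (int (tri r) + (int 64 * int (tri k) + int (nat (28 + 8 * r)) * k))"
        by simp
      then have "q ^ tri (8 * k + r) = q ^ tri r * q powi (int 64 * int (tri k) + int (nat (28 + 8 * r)) * k)"
        using q0 by (subst (asm) power_int_add) auto
      ultimately show ?thesis by simp
    qed
    then show "((\<lambda>k. q ^ tri (8 * k + r) * z powi (8 * k + r)) has_sum
        z powi r * q ^ tri r * Jbar (nat (28 + 8 * r)) 64 q) UNIV"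
      using r by (simp only:) (intro has_sum_cmult_right Jbar_has_sum q, auto)
  qed simp
  also have "{- 3..<- 3 + 8} = {- 3, - 2, - 1, 0, 1, 2, 3, 4 :: int}" by auto
  also have "(\<Sum>r\<in>{- 3, - 2, - 1, 0, 1, 2, 3, 4}. z powi r * q ^ tri r * Jbar (nat (28 + 8 * r)) 64 q)
      = z powi (- 3) * q ^ 6 * Jbar 4 64 q + z powi (- 2) * q ^ 3 * Jbar 12 64 q + z powi (- 1) * q * Jbar 20 64 q
        + Jbar 28 64 q + z * Jbar 36 64 q + z ^ 2 * q * Jbar 44 64 q + z ^ 3 * q ^ 3 * Jbar 52 64 q
        + z ^ 4 * q ^ 6 * Jbar 60 64 q"
    by (simp add: tri_def)
  finally have eq: "jtheta (- z) q = z powi (- 3) * q ^ 6 * Jbar 4 64 q + z powi (- 2) * q ^ 3 * Jbar 12 64 q + z powi (- 1) * q * Jbar 20 64 q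
        + Jbar 28 64 q + z * Jbar 36 64 q + z ^ 2 * q * Jbar 44 64 q + z ^ 3 * q ^ 3 * Jbar 52 64 q
        + z ^ 4 * q ^ 6 * Jbar 60 64 q" .
  \<comment> \<open>The residues r and 1 - r have the same \<open>tri\<close>, and their exponents
    28 + 8r and 28 + 8(1 - r) add up to 64; hence the paired coefficients z^r + z^(1-r).\<close>
  have reflect: "Jbar 4 64 q = Jbar 60 64 q" "Jbar 12 64 q = Jbar 52 64 q" "Jbar 36 64 q = Jbar 28 64 q"
    "Jbar 44 64 q = Jbar 20 64 q"
    using Jbar_reflect[OF q0, of _ 64, of 60] Jbar_reflect[OF q0, of _ 64, of 52]
      Jbar_reflect[OF q0, of _ 64, of 28] Jbar_reflect[OF q0, of _ 64, of 20] by simp_all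
  show ?thesis unfolding eq reflect by (simp add: algebra_simps)
qed

text \<open>The series is the sum of (-1)^k q^(k^2), split by parity. The representatives -1 and 0
  give exponents 0 and 4, both below 8; the representative 1 would give 8.\<close>

lemma jtheta_dissect_2:
  assumes q: "0 < norm q" "norm q < 1"
  shows "jtheta q (q ^ 2) = Jbar 4 8 q - q * Jbar 0 8 q"
proof -
  have q0: "q \<noteq> 0" using q by auto
  have "norm q ^ 2 < norm q ^ 1" using q by (intro power_strict_decreasing) auto
  then have "((\<lambda>k. (q ^ 2) ^ tri k * (- q) powi k) has_sum jtheta (- (- q)) (q ^ 2)) UNIV"
    using q0 q by (intro jacobi_triple_product norm_power_less_one) (auto simp: norm_power)
  then have "((\<lambda>k. (q ^ 2) ^ tri k * (- q) powi k) has_sum jtheta q (q ^ 2)) UNIV" by simp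
  then have "jtheta q (q ^ 2) = (\<Sum>r\<in>{- 1..<- 1 + 2}. (- q) powi r * (q ^ 2) ^ tri r * Jbar (nat (4 + 4 * r)) 8 q)"
  proof (rule has_sum_residues[rotated])
    fix r :: int assume r: "r \<in> {- 1..<- 1 + 2}"
    have "(q ^ 2) ^ tri (2 * k + r) * (- q) powi (2 * k + r)
        = (- q) powi r * (q ^ 2) ^ tri r * q powi (int 8 * int (tri k) + int (nat (4 + 4 * r)) * k)" for k
    proof -
      have *: "(- q) powi (2 * k + r) = (- q) powi r * q powi (2 * k)"
      proof -
        have "(- q) powi (2 * k) = q powi (2 * k)" by (rule power_int_minus_left_even) simp
        then show ?thesis using power_int_add[of "- q" "2 * k" r] q0 by simp
      qed
      have "2 * int (tri (2 * k + r)) + 2 * k = 2 * int (tri r) + (int 8 * int (tri k) + int (nat (4 + 4 * r)) * k)"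
        using r two_tri[of k] two_tri[of r] two_tri[of "2 * k + r"] by (simp add: algebra_simps)
      then have "q powi (2 * int (tri (2 * k + r)) + 2 * k)
          = q powi (2 * int (tri r) + (int 8 * int (tri k) + int (nat (4 + 4 * r)) * k))"
        by simp
      then have "q powi (2 * int (tri (2 * k + r))) * q powi (2 * k)
          = q powi (2 * int (tri r)) * q powi (int 8 * int (tri k) + int (nat (4 + 4 * r)) * k)"
        using q0 by (simp only: power_int_add simp_thms)
      then have "(q ^ 2) ^ tri (2 * k + r) * q powi (2 * k)
          = (q ^ 2) ^ tri r * q powi (int 8 * int (tri k) + int (nat (4 + 4 * r)) * k)"
        by (simp add: power_int_mult)
      with * show ?thesis by (simp add: mult_ac)
    qed
    then show "((\<lambda>k. (q ^ 2) ^ tri (2 * k + r) * (- q) powi (2 * k + r)) has_sum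
        (- q) powi r * (q ^ 2) ^ tri r * Jbar (nat (4 + 4 * r)) 8 q) UNIV"
      using r by (simp only:) (intro has_sum_cmult_right Jbar_has_sum q, auto)
  qed simp
  also have "{- 1..<- 1 + 2} = {- 1, 0 :: int}" by auto
  also have "(\<Sum>r\<in>{- 1, 0}. (- q) powi r * (q ^ 2) ^ tri r * Jbar (nat (4 + 4 * r)) 8 q) = Jbar 4 8 q - q * Jbar 0 8 q"
    using q0 by (simp add: tri_def power_int_minus power2_eq_square field_simps)
  finally show ?thesis .
qed

section \<open>Product evaluations of the crank generating function at the eighth roots of
  unity\<close>

lemma Jm_eq:
  assumes "0 < norm q" "norm q < 1" "0 < m"
  shows "Jm m q = qpoch (q ^ m) (q ^ m)"
proof -
  have q0: "q \<noteq> 0" using assms by auto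
  have e: "q ^ (3 * m) / q ^ m = q ^ (2 * m)"
    using q0 by (simp add: power_diff[symmetric])
  have "qpoch (q ^ m) (q ^ m) = (\<Prod>r<3. qpoch ((q ^ m) ^ r * q ^ m) ((q ^ m) ^ 3))"
    by (intro qpoch_dissect norm_power_less_one assms) simp
  also have "\<dots> = qpoch (q ^ m) (q ^ (3 * m)) * qpoch (q ^ (2 * m)) (q ^ (3 * m)) * qpoch (q ^ (3 * m)) (q ^ (3 * m))"
    by (simp add: eval_nat_numeral power_add mult_ac)
  finally show ?thesis
    unfolding Jm_def Jam_def jtheta_def e by simp
qed

text \<open>Gauss's evaluation j(q;q^2) = (q)/(-q) with the denominator cleared: the left factor is
  (q;q^2)(q), and (q)(-q) = (q^2;q^2) restores the even factors of (q).\<close>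

lemma jtheta_square_base:
  assumes "0 < norm q" "norm q < 1"
  shows "jtheta q (q ^ 2) * qpoch (- q) q = qpoch q q"
proof -
  have q0: "q \<noteq> 0" using assms by auto
  have d: "qpoch q q = qpoch q (q ^ 2) * qpoch (q ^ 2) (q ^ 2)"
    using qpoch_dissect[OF assms(2), of 2 q] by (simp add: eval_nat_numeral)
  have m: "qpoch q q * qpoch (- q) q = qpoch (q ^ 2) (q ^ 2)"
    by (rule qpoch_mult_minus[OF assms(2)])
  have "jtheta q (q ^ 2) = qpoch q (q ^ 2) * qpoch q q"
    unfolding jtheta_def d using q0 by (simp add: power2_eq_square)
  then have "jtheta q (q ^ 2) * qpoch (- q) q = qpoch q (q ^ 2) * (qpoch q q * qpoch (- q) q)"
    by simp
  also have "\<dots> = qpoch q (q ^ 2) * qpoch (q ^ 2) (q ^ 2)" by (simp only: m)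
  also have "\<dots> = qpoch q q" by (rule d[symmetric])
  finally show ?thesis .
qed

definition crank_prod :: "complex \<Rightarrow> complex \<Rightarrow> complex" where
  "crank_prod z q = qpoch q q / (qpoch (z * q) q * qpoch (q / z) q)"

lemma crank_prod_nonzero_denom:
  assumes "norm q < 1" "norm z = 1"
  shows "qpoch (z * q) q \<noteq> 0" "qpoch (q / z) q \<noteq> 0"
  by (rule qpoch_nonzero'; use assms in \<open>simp add: norm_mult norm_divide\<close>)+

text \<open>Since z^4 = -1, \<open>s\<close> is z + 1/z. The product is invariant under z -> 1/z,
  which is why its coefficients can be written in \<open>s\<close>.\<close>

lemma crank_prod_eighth_root:
  assumes q: "0 < norm q" "norm q < 1" and z: "z ^ 4 = - 1"
  defines "s \<equiv> z - z ^ 3"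
  shows "crank_prod z q = 1 / Jm 4 q * Jam 4 8 q * (Jbar 28 64 q + (s - 1) * q * Jbar 20 64 q
     + (1 - s) * q ^ 3 * Jbar 52 64 q - q ^ 6 * Jbar 60 64 q)"
proof -
  have q4: "0 < norm (q ^ 4)" "norm (q ^ 4) < 1"
    using q norm_power_less_one[of q 4] by (auto simp: norm_power)
  have "norm z ^ 4 = 1" using z by (metis norm_power norm_one norm_minus_cancel)
  then have nz: "norm z = 1" using power_eq_1_iff[of "norm z" 4] by simp
  then have z0: "z \<noteq> 0" by auto
  have z1: "1 + z \<noteq> 0"
  proof
    assume "1 + z = 0"
    then have "z = - 1" by (simp add: add_eq_0_iff)
    with z show False by simp
  qed
  note nd = crank_prod_nonzero_denom[OF q(2) nz]
  have nd': "qpoch (- (q ^ 4)) (q ^ 4) \<noteq> 0"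
    by (intro qpoch_nonzero') (use q4 in auto)
  have inv: "1 / z = - (z ^ 3)" "1 / z ^ 2 = - (z ^ 2)"
    using z z0 by (simp_all add: field_simps eval_nat_numeral)
  have "qpoch (z * q) q * qpoch (- (z * q)) q * (qpoch (q / z) q * qpoch (- (q / z)) q)
      = qpoch ((z * q) ^ 2) (q ^ 2) * qpoch ((q / z) ^ 2) (q ^ 2)"
    by (simp only: qpoch_mult_minus[OF q(2)])
  also have "(q / z) ^ 2 = - ((z * q) ^ 2)"
  proof -
    have "(q / z) ^ 2 = q ^ 2 * (1 / z ^ 2)" by (simp add: power_divide)
    then show ?thesis unfolding inv(2) by (simp add: power_mult_distrib)
  qed
  also have "qpoch ((z * q) ^ 2) (q ^ 2) * qpoch (- ((z * q) ^ 2)) (q ^ 2) = qpoch (((z * q) ^ 2) ^ 2) ((q ^ 2) ^ 2)"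
    by (intro qpoch_mult_minus norm_power_less_one q) simp
  also have "((z * q) ^ 2) ^ 2 = - (q ^ 4)"
    using z by (simp add: power_mult_distrib flip: power_mult)
  also have "(q ^ 2) ^ 2 = q ^ 4"
    by (simp flip: power_mult)
  finally have pr: "qpoch (z * q) q * qpoch (- (z * q)) q * (qpoch (q / z) q * qpoch (- (q / z)) q) = qpoch (- (q ^ 4)) (q ^ 4)" .
  have "jtheta (- z) q = (1 + z) * (qpoch (- (z * q)) q * qpoch (- (q / z)) q * qpoch q q)"
    unfolding jtheta_def using qpoch_Suc[OF q(2), of "- z"] by (simp add: mult_ac)
  then have e1: "crank_prod z q * ((1 + z) * qpoch (- (q ^ 4)) (q ^ 4)) = jtheta (- z) q"
    unfolding pr[symmetric] crank_prod_def using nd by (simp add: field_simps)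
  have 1: "crank_prod z q = jtheta (- z) q / (1 + z) * (1 / qpoch (- (q ^ 4)) (q ^ 4))"
    unfolding e1[symmetric] using z1 nd' by simp
  have 2: "1 / qpoch (- (q ^ 4)) (q ^ 4) = Jam 4 8 q / Jm 4 q"
  proof -
    have "Jam 4 8 q = jtheta (q ^ 4) ((q ^ 4) ^ 2)" by (simp add: Jam_def flip: power_mult)
    then have "Jam 4 8 q * qpoch (- (q ^ 4)) (q ^ 4) = Jm 4 q"
      using jtheta_square_base[OF q4] Jm_eq[OF q, of 4] by simp
    moreover have "Jm 4 q \<noteq> 0" unfolding Jm_eq[OF q, of 4, simplified]
      by (intro qpoch_nonzero' q4)
    ultimately show ?thesis using nd' by (simp add: field_simps)
  qed
  have "z ^ 8 = (z ^ 4) ^ 2" by (simp flip: power_mult)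
  then have z8: "z ^ 8 = 1" using z by simp
  have pw: "z powi (- 1) = - (z ^ 3)" "z powi (- 2) = - (z ^ 2)" "z powi (- 3) = - z"
  proof -
    show "z powi (- 1) = - (z ^ 3)" "z powi (- 2) = - (z ^ 2)"
      using inv by (simp_all add: power_int_minus divide_inverse)
    show "z powi (- 3) = - z"
      using z z0 by (simp add: power_int_minus field_simps eval_nat_numeral)
  qed
  have "jtheta (- z) q = (1 + z) * (Jbar 28 64 q + (s - 1) * q * Jbar 20 64 q
     + (1 - s) * q ^ 3 * Jbar 52 64 q - q ^ 6 * Jbar 60 64 q)"
  proof -
    \<comment> \<open>The factor 1 + z of j(-z;q) divides every paired coefficient, so the quotient
      has polynomial coefficients in \<open>s\<close>.\<close>
    have c: "z ^ 2 + - (z ^ 3) = (1 + z) * (s - 1)" "z ^ 3 + - (z ^ 2) = (1 + z) * (1 - s)"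
      "z ^ 4 + - z = - (1 + z)"
      using z unfolding s_def by algebra+
    show ?thesis
      unfolding jtheta_dissect_8[OF q z8] pw c by (simp add: algebra_simps)
  qed
  then have 3: "jtheta (- z) q / (1 + z) = Jbar 28 64 q + (s - 1) * q * Jbar 20 64 q
     + (1 - s) * q ^ 3 * Jbar 52 64 q - q ^ 6 * Jbar 60 64 q"
    using z1 by simp
  show ?thesis unfolding 1 2 3 by simp
qed

text \<open>Because 1/z = -z, the denominator is (-q^2;q^2). Multiplied by J_4 = (q^2;q^2)(-q^2;q^2)
  the value becomes (q)(q^2;q^2), which is j(q;q^2) times half of j(-1;q).\<close>

lemma crank_prod_fourth_root:
  assumes q: "0 < norm q" "norm q < 1" and z: "z ^ 2 = - 1"
  shows "crank_prod z q = 1 / Jm 4 q * (Jbar 4 8 q - q * Jbar 0 8 q)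
    * (Jbar 28 64 q + q * Jbar 20 64 q + q ^ 3 * Jbar 52 64 q + q ^ 6 * Jbar 60 64 q)"
proof -
  have z0: "z \<noteq> 0" using z by auto
  have q2: "norm (q ^ 2) < 1" using q norm_power_less_one[of q 2] by simp
  have nd: "qpoch (- (q ^ 2)) (q ^ 2) \<noteq> 0" "qpoch (q ^ 2) (q ^ 2) \<noteq> 0"
    by (intro qpoch_nonzero'; use q2 in simp)+
  have "q / z = - (z * q)" using z z0 by (simp add: field_simps power2_eq_square)
  then have "qpoch (z * q) q * qpoch (q / z) q = qpoch ((z * q) ^ 2) (q ^ 2)"
    using qpoch_mult_minus[OF q(2)] by simp
  also have "(z * q) ^ 2 = - (q ^ 2)" using z by (simp add: power_mult_distrib)
  finally have 1: "crank_prod z q = qpoch q q / qpoch (- (q ^ 2)) (q ^ 2)"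
    unfolding crank_prod_def by simp
  have 2: "Jm 4 q = qpoch (q ^ 2) (q ^ 2) * qpoch (- (q ^ 2)) (q ^ 2)"
    unfolding qpoch_mult_minus[OF q2] Jm_eq[OF q, of 4, simplified] by (simp flip: power_mult)
  have 3: "qpoch q q * qpoch (- q) q = qpoch (q ^ 2) (q ^ 2)"
    by (rule qpoch_mult_minus[OF q(2)])
  \<comment> \<open>The 2 is the factor 1 + z at z = 1; it reappears in every coefficient of the
    dissection and cancels.\<close>
  have j1: "jtheta (- 1) q = 2 * (qpoch (- q) q * qpoch (- q) q * qpoch q q)"
    unfolding jtheta_def using qpoch_Suc[OF q(2), of "- 1"] by simp
  have j2: "jtheta (- 1) q = 2 * (Jbar 28 64 q + q * Jbar 20 64 q + q ^ 3 * Jbar 52 64 q + q ^ 6 * Jbar 60 64 q)"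
    using jtheta_dissect_8[OF q, of 1] by (simp add: algebra_simps)
  have 4: "Jbar 28 64 q + q * Jbar 20 64 q + q ^ 3 * Jbar 52 64 q + q ^ 6 * Jbar 60 64 q
      = qpoch (- q) q * qpoch (- q) q * qpoch q q"
    using trans[OF j2[symmetric] j1] by (subst (asm) mult_left_cancel) auto
  have "(Jbar 4 8 q - q * Jbar 0 8 q) * (Jbar 28 64 q + q * Jbar 20 64 q + q ^ 3 * Jbar 52 64 q + q ^ 6 * Jbar 60 64 q)
      = (jtheta q (q ^ 2) * qpoch (- q) q) * (qpoch q q * qpoch (- q) q)"
    unfolding 4 jtheta_dissect_2[OF q] by (simp add: mult_ac)
  also have "\<dots> = qpoch q q * qpoch (q ^ 2) (q ^ 2)"
    unfolding jtheta_square_base[OF q] 3 ..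
  finally have 5: "(Jbar 4 8 q - q * Jbar 0 8 q) * (Jbar 28 64 q + q * Jbar 20 64 q + q ^ 3 * Jbar 52 64 q + q ^ 6 * Jbar 60 64 q)
      = qpoch q q * qpoch (q ^ 2) (q ^ 2)" .
  show ?thesis unfolding mult.assoc 5 unfolding 1 2 using nd by simp
qed

text \<open>The theta function is taken at i and not at -1: (iq)(-iq) = (-q^2;q^2) supplies the
  missing factor of J_4, and each paired coefficient of the dissection is 1 + i or its
  negative.\<close>

lemma crank_prod_minus_one:
  assumes q: "0 < norm q" "norm q < 1"
  shows "crank_prod (- 1) q = 1 / Jm 4 q * (Jbar 4 8 q - q * Jbar 0 8 q)
    * (Jbar 28 64 q - q * Jbar 20 64 q - q ^ 3 * Jbar 52 64 q + q ^ 6 * Jbar 60 64 q)"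
proof -
  have q2: "norm (q ^ 2) < 1" using q norm_power_less_one[of q 2] by simp
  have nd: "qpoch (- (q ^ 2)) (q ^ 2) \<noteq> 0" "qpoch (q ^ 2) (q ^ 2) \<noteq> 0"
    by (intro qpoch_nonzero'; use q2 in simp)+
  have nd': "qpoch (- q) q \<noteq> 0" "qpoch q q \<noteq> 0"
    by (intro qpoch_nonzero'; use q in simp)+
  have 1: "crank_prod (- 1) q = qpoch q q / (qpoch (- q) q * qpoch (- q) q)"
    unfolding crank_prod_def by simp
  have 2: "Jm 4 q = qpoch (q ^ 2) (q ^ 2) * qpoch (- (q ^ 2)) (q ^ 2)"
    unfolding qpoch_mult_minus[OF q2] Jm_eq[OF q, of 4, simplified] by (simp flip: power_mult)
  have 3: "qpoch (q ^ 2) (q ^ 2) = qpoch q q * qpoch (- q) q"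
    by (rule qpoch_mult_minus[OF q(2), symmetric])
  have i: "1 + \<i> \<noteq> 0" by (simp add: complex_eq_iff)
  have "jtheta (- \<i>) q = (1 + \<i>) * (qpoch (\<i> * q) q * qpoch (- (\<i> * q)) q * qpoch q q)"
    unfolding jtheta_def using qpoch_Suc[OF q(2), of "- \<i>"] by (simp add: mult_ac)
  also have "qpoch (\<i> * q) q * qpoch (- (\<i> * q)) q = qpoch (- (q ^ 2)) (q ^ 2)"
    unfolding qpoch_mult_minus[OF q(2)] by (simp add: power_mult_distrib)
  finally have j1: "jtheta (- \<i>) q = (1 + \<i>) * (qpoch (- (q ^ 2)) (q ^ 2) * qpoch q q)" .
  have j2: "jtheta (- \<i>) q = (1 + \<i>) * (Jbar 28 64 q - q * Jbar 20 64 q - q ^ 3 * Jbar 52 64 q + q ^ 6 * Jbar 60 64 q)"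
  proof -
    have i8: "\<i> ^ 8 = 1" and i: "\<i> ^ 2 + \<i> powi (- 1) = - (1 + \<i>)"
      "\<i> ^ 3 + \<i> powi (- 2) = - (1 + \<i>)" "\<i> ^ 4 + \<i> powi (- 3) = 1 + \<i>"
      by (simp_all add: power_int_minus eval_nat_numeral)
    show ?thesis
      unfolding jtheta_dissect_8[OF q i8] i by (simp add: algebra_simps)
  qed
  have 4: "Jbar 28 64 q - q * Jbar 20 64 q - q ^ 3 * Jbar 52 64 q + q ^ 6 * Jbar 60 64 q
      = qpoch (- (q ^ 2)) (q ^ 2) * qpoch q q"
    using trans[OF j2[symmetric] j1] i by (subst (asm) mult_left_cancel) auto
  have 5: "Jbar 4 8 q - q * Jbar 0 8 q = qpoch q q / qpoch (- q) q"
    using jtheta_square_base[OF q] nd' unfolding jtheta_dissect_2[OF q] by (simp add: field_simps)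
  show ?thesis unfolding 4 5 1 2 3 using nd nd' by (simp add: field_simps)
qed

section \<open>Assembling the eight deviations\<close>

lemma powi_eq_1_iff_8_dvd:
  fixes z :: complex
  assumes z: "z ^ 4 = - 1"
  shows "z powi k = 1 \<longleftrightarrow> int 8 dvd k"
proof -
  have z0: "z \<noteq> 0" using z by auto
  have "z ^ 8 = (z ^ 4) ^ 2" by (simp flip: power_mult)
  then have z8: "z ^ 8 = 1" using z by simp
  define r where "r = nat (k mod 8)"
  have k: "k = 8 * (k div 8) + int r" and r8: "r < 8"
    by (auto simp: r_def nat_less_iff)
  have "z powi k = z ^ r"
    by (subst k, subst power_int_add) (auto simp: z0 z8 power_int_mult)
  moreover have "z ^ r = 1 \<longleftrightarrow> r = 0"
  proof
    \<comment> \<open>The fourth power gives (-1)^r = 1, so r is even. Squaring excludes r = 2 and r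
      = 6, as z^4 and z^12 are -1.\<close>
    assume r: "z ^ r = 1"
    have p: "z ^ (4 * n) = (- 1) ^ n" for n by (simp add: power_mult z)
    have "(z ^ r) ^ 4 = z ^ (4 * r)" by (simp add: mult.commute flip: power_mult)
    with r have "(- 1 :: complex) ^ r = 1" by (simp add: p)
    then have "even r" by (cases "even r") auto
    with r8 consider "r = 0" | "r = 2" | "r = 4" | "r = 6" by (auto elim!: evenE) linarith
    then show "r = 0"
    proof cases
      case 2
      have "(z ^ r) ^ 2 = z ^ (4 * 1)" unfolding 2 by (simp flip: power_mult)
      with r p[of 1] show ?thesis by simp
    next
      case 3
      with r z show ?thesis by simp
    next
      case 4
      have "(z ^ r) ^ 2 = z ^ (4 * 3)" unfolding 4 by (simp flip: power_mult)
      with r p[of 3] show ?thesis by simp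
    qed
  qed simp
  moreover have "int 8 dvd k \<longleftrightarrow> r = 0" by (auto simp: r_def dvd_eq_mod_eq_0)
  ultimately show ?thesis by simp
qed

text \<open>With v = z^(-a) the root z^j has weight v^j. The roots z and z^7 are inverse to each
  other and share \<open>s\<close>, z^3 and z^5 share \<open>- s\<close>, z^2 and z^6 are the two
  square roots of -1, and z^4 = -1.\<close>

lemma crank_dev_8:
  fixes q z :: complex
  assumes q: "0 < norm q" "norm q < 1" and z: "z ^ 4 = - 1"
  defines "s \<equiv> z - z ^ 3"
  defines "F \<equiv> \<lambda>s. 1 / Jm 4 q * Jam 4 8 q * (Jbar 28 64 q + (s - 1) * q * Jbar 20 64 q
     + (1 - s) * q ^ 3 * Jbar 52 64 q - q ^ 6 * Jbar 60 64 q)"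
  assumes v: "z powi (- a) = v"
  shows "crank_dev a 8 q = (F s * (v + v ^ 7) + F (- s) * (v ^ 3 + v ^ 5)
    + 1 / Jm 4 q * (Jbar 4 8 q - q * Jbar 0 8 q)
      * (Jbar 28 64 q + q * Jbar 20 64 q + q ^ 3 * Jbar 52 64 q + q ^ 6 * Jbar 60 64 q) * (v ^ 2 + v ^ 6)
    + 1 / Jm 4 q * (Jbar 4 8 q - q * Jbar 0 8 q)
      * (Jbar 28 64 q - q * Jbar 20 64 q - q ^ 3 * Jbar 52 64 q + q ^ 6 * Jbar 60 64 q) * v ^ 4) / 8"
proof -
  have p: "(z ^ j) powi (- a) = v ^ j" for j
    unfolding v[symmetric] by (simp flip: power_int_of_nat power_int_mult add: mult.commute)
  have odd: "crank_prod (z ^ 1) q = F s" "crank_prod (z ^ 3) q = F (- s)"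
    "crank_prod (z ^ 5) q = F (- s)" "crank_prod (z ^ 7) q = F s"
  proof -
    have *: "crank_prod y q = F t" if "y ^ 4 = - 1" "y - y ^ 3 = t" for y t
      unfolding F_def that(2)[symmetric] by (rule crank_prod_eighth_root[OF q that(1)])
    have e: "(z ^ 1) ^ 4 = - 1" "(z ^ 3) ^ 4 = - 1" "(z ^ 5) ^ 4 = - 1" "(z ^ 7) ^ 4 = - 1"
      using z by algebra+
    have cube: "(z ^ 3) ^ 3 = z ^ 4 * z ^ 4 * z" by algebra
    have red: "z ^ 5 = - z" "z ^ 7 = - (z ^ 3)"
      using z by algebra+
    have cube': "(z ^ 3) ^ 3 = z" unfolding cube z by simp
    have d: "z ^ 1 - (z ^ 1) ^ 3 = s" "z ^ 3 - (z ^ 3) ^ 3 = - s" "z ^ 5 - (z ^ 5) ^ 3 = - s"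
      "z ^ 7 - (z ^ 7) ^ 3 = s"
      unfolding red s_def using cube' by (simp_all only: power_minus_odd odd_numeral power_one_right minus_minus minus_diff_eq) simp_all
    show "crank_prod (z ^ 1) q = F s" "crank_prod (z ^ 3) q = F (- s)"
      "crank_prod (z ^ 5) q = F (- s)" "crank_prod (z ^ 7) q = F s"
      by (fact *[OF e(1) d(1)], fact *[OF e(2) d(2)], fact *[OF e(3) d(3)], fact *[OF e(4) d(4)])
  qed
  have even: "crank_prod (z ^ 2) q = 1 / Jm 4 q * (Jbar 4 8 q - q * Jbar 0 8 q)
      * (Jbar 28 64 q + q * Jbar 20 64 q + q ^ 3 * Jbar 52 64 q + q ^ 6 * Jbar 60 64 q)"
    "crank_prod (z ^ 6) q = 1 / Jm 4 q * (Jbar 4 8 q - q * Jbar 0 8 q)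
      * (Jbar 28 64 q + q * Jbar 20 64 q + q ^ 3 * Jbar 52 64 q + q ^ 6 * Jbar 60 64 q)"
    by (rule crank_prod_fourth_root[OF q]; use z in algebra)+
  have "{1..<8} = {1, 2, 3, 4, 5, 6, 7 :: nat}" by auto
  then have expand: "crank_dev a 8 q = (crank_prod (z ^ 1) q * v ^ 1 + crank_prod (z ^ 2) q * v ^ 2
     + crank_prod (z ^ 3) q * v ^ 3 + crank_prod (z ^ 4) q * v ^ 4 + crank_prod (z ^ 5) q * v ^ 5
     + crank_prod (z ^ 6) q * v ^ 6 + crank_prod (z ^ 7) q * v ^ 7) / 8"
    using crank_dev_filter[of 8 z q a] powi_eq_1_iff_8_dvd[OF z] q(2)
    unfolding p crank_prod_def[symmetric] by (simp add: add.assoc)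
  have regroup: "A * v ^ 1 + C * v ^ 2 + B * v ^ 3 + D * v ^ 4 + B * v ^ 5 + C * v ^ 6 + A * v ^ 7
      = A * (v + v ^ 7) + B * (v ^ 3 + v ^ 5) + C * (v ^ 2 + v ^ 6) + D * v ^ 4" for A B C D
    by (simp add: algebra_simps)
  show ?thesis
    unfolding expand odd even z crank_prod_minus_one[OF q] regroup ..
qed

theorem theorem7p1:
  fixes q :: complex
  assumes "0 < norm q" and "norm q < 1"
  shows "crank_dev 0 8 q = theta8 q 3 (-1) 1 (-3) (-1) 3 1 (-3) + theta8' q 1 (-1) (-1) 1
    \<and> crank_dev 1 8 q = theta8 q (-1) (-1) 1 1 (-1) (-1) 1 1 + theta8' q 0 1 0 (-1)
    \<and> crank_dev 7 8 q = theta8 q (-1) (-1) 1 1 (-1) (-1) 1 1 + theta8' q 0 1 0 (-1)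
    \<and> crank_dev 2 8 q = theta8 q (-1) 3 (-3) 1 3 (-1) (-3) 1
    \<and> crank_dev 6 8 q = theta8 q (-1) 3 (-3) 1 3 (-1) (-3) 1
    \<and> crank_dev 3 8 q = theta8 q (-1) (-1) 1 1 (-1) (-1) 1 1 + theta8' q 0 (-1) 0 1
    \<and> crank_dev 5 8 q = theta8 q (-1) (-1) 1 1 (-1) (-1) 1 1 + theta8' q 0 (-1) 0 1
    \<and> crank_dev 4 8 q = theta8 q 3 (-1) 1 (-3) (-1) 3 1 (-3) + theta8' q (-1) 1 1 (-1)"
proof -
  define z where "z = cis (pi / 4)"
  define s where "s = z - z ^ 3"
  define k where "k = 1 / Jm 4 q"
  have z: "z ^ 4 = - 1" unfolding z_def Complex.DeMoivre by simp
  have z0: "z \<noteq> 0" unfolding z_def by (rule cis_neq_zero)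
  \<comment> \<open>The only property of \<open>s\<close> that the odd cases use to reach rational
    coefficients.\<close>
  have s2: "s ^ 2 = 2" unfolding s_def using z by algebra
  note dev = crank_dev_8[OF assms z, folded s_def k_def]
  have t8: "theta8 q a0 a1 a2 a3 a4 a5 a6 a7 =
      k * (a0 * Jbar 4 8 q * Jbar 28 64 q + a1 * q ^ 4 * Jbar 0 8 q * Jbar 52 64 q
       + a2 * q * Jbar 4 8 q * Jbar 20 64 q + a3 * q * Jbar 0 8 q * Jbar 28 64 q
       + a4 * q ^ 2 * Jbar 0 8 q * Jbar 20 64 q + a5 * q ^ 6 * Jbar 4 8 q * Jbar 60 64 q
       + a6 * q ^ 3 * Jbar 4 8 q * Jbar 52 64 q + a7 * q ^ 7 * Jbar 0 8 q * Jbar 60 64 q) / 8"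
    for a0 a1 a2 a3 a4 a5 a6 a7
    unfolding theta8_def k_def by simp
  have t8': "theta8' q c0 c1 c2 c3 =
      4 * k * (c0 * Jam 4 8 q * Jbar 28 64 q + c1 * q * Jam 4 8 q * Jbar 20 64 q
       + c2 * q ^ 6 * Jam 4 8 q * Jbar 60 64 q + c3 * q ^ 3 * Jam 4 8 q * Jbar 52 64 q) / 8"
    for c0 c1 c2 c3
  proof -
    have "1 / (2 * J) * X = 4 * (1 / J) * X / 8" for J X :: complex by simp
    then show ?thesis unfolding theta8'_def k_def .
  qed
  note theta = t8 t8' add_divide_distrib[symmetric]
  have theta0: "theta8 q a0 a1 a2 a3 a4 a5 a6 a7 = theta8 q a0 a1 a2 a3 a4 a5 a6 a7 + theta8' q 0 0 0 0"
    for a0 a1 a2 a3 a4 a5 a6 a7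
    by (simp add: theta8'_def)
  have zpow: "z powi (- int a) = v" if "z ^ a * v = 1" for a v
    using that z0 by (simp add: power_int_minus field_simps)
  have inv: "z ^ 1 * - (z ^ 3) = 1" "z ^ 2 * - (z ^ 2) = 1" "z ^ 3 * - z = 1" "z ^ 4 * - 1 = 1"
    "z ^ 5 * z ^ 3 = 1" "z ^ 6 * z ^ 2 = 1" "z ^ 7 * z = 1"
    using z by algebra+
  have v: "z powi (- 0) = 1" "z powi (- 1) = - (z ^ 3)" "z powi (- 2) = - (z ^ 2)"
    "z powi (- 3) = - z" "z powi (- 4) = - 1" "z powi (- 5) = z ^ 3"
    "z powi (- 6) = z ^ 2" "z powi (- 7) = z"
    using inv[THEN zpow] by simp_all
  \<comment> \<open>For odd a, v is itself a primitive eighth root: the roots i and -i drop out, and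
    the products at s and -s get opposite weights.\<close>
  have odd: "v + v ^ 7 = v - v ^ 3" "v ^ 3 + v ^ 5 = - (v - v ^ 3)" "v ^ 2 + v ^ 6 = 0"
    if "v ^ 4 = - 1" for v :: complex
    using that by algebra+
  \<comment> \<open>For a = 2 and a = 6 the primitive roots drop out, so no \<open>theta8'\<close>
    term remains.\<close>
  have even: "v + v ^ 7 = 0" "v ^ 3 + v ^ 5 = 0" "v ^ 2 + v ^ 6 = - 2" "v ^ 4 = 1"
    if "v ^ 2 = - 1" for v :: complex
    using that by algebra+
  \<comment> \<open>For a = 0 and a = 4 the products at s and -s get equal weights, so
    \<open>s\<close> cancels; passing from v = 1 to v = -1 only changes the sign of the
    \<open>theta8'\<close> part.\<close>
  have d0: "crank_dev 0 8 q = theta8 q 3 (-1) 1 (-3) (-1) 3 1 (-3) + theta8' q 1 (-1) (-1) 1"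
    unfolding theta dev[OF v(1)] by (simp, algebra)
  have d4: "crank_dev 4 8 q = theta8 q 3 (-1) 1 (-3) (-1) 3 1 (-3) + theta8' q (-1) 1 1 (-1)"
    unfolding theta dev[OF v(5)] by (simp, algebra)
  \<comment> \<open>Opposite weights isolate the part linear in \<open>s\<close>. With t = s or t =
    -s the factor s * t is 2 or -2, the sign that separates a = 1, 7 from a = 3, 5.\<close>
  have F_odd: "k * Jam 4 8 q * (Jbar 28 64 q + (s - 1) * q * Jbar 20 64 q
     + (1 - s) * q ^ 3 * Jbar 52 64 q - q ^ 6 * Jbar 60 64 q) * t
     + k * Jam 4 8 q * (Jbar 28 64 q + (- s - 1) * q * Jbar 20 64 q
     + (1 - - s) * q ^ 3 * Jbar 52 64 q - q ^ 6 * Jbar 60 64 q) * - t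
     = s * t * (2 * k * Jam 4 8 q * (q * Jbar 20 64 q - q ^ 3 * Jbar 52 64 q))" for t
    by algebra
  have ss: "s * s = 2" "s * - s = - 2" using s2 by (simp_all add: power2_eq_square)
  have d1: "crank_dev a 8 q = theta8 q (-1) (-1) 1 1 (-1) (-1) 1 1 + theta8' q 0 1 0 (-1)"
    if "z powi (- a) = v" "v ^ 4 = - 1" "v - v ^ 3 = s" for a v
    unfolding theta dev[OF that(1)] odd[OF that(2)] that(2,3) F_odd ss
    by (intro arg_cong[where f = "\<lambda>x. x / 8"]) algebra
  have d3: "crank_dev a 8 q = theta8 q (-1) (-1) 1 1 (-1) (-1) 1 1 + theta8' q 0 (-1) 0 1"
    if "z powi (- a) = v" "v ^ 4 = - 1" "v - v ^ 3 = - s" for a v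
    unfolding theta dev[OF that(1)] odd[OF that(2)] that(2,3) F_odd ss
    by (intro arg_cong[where f = "\<lambda>x. x / 8"]) algebra
  have d2: "crank_dev a 8 q = theta8 q (-1) 3 (-3) 1 3 (-1) (-3) 1"
    if "z powi (- a) = v" "v ^ 2 = - 1" for a v
    unfolding t8 dev[OF that(1)] even[OF that(2)]
    by (intro arg_cong[where f = "\<lambda>x. x / 8"]) algebra
  have cube: "(z ^ 3) ^ 3 = z ^ 4 * z ^ 4 * z" by algebra
  have cube': "(z ^ 3) ^ 3 = z" unfolding cube z by simp
  have root4: "(- (z ^ 3)) ^ 4 = - 1" "(- z) ^ 4 = - 1" "(z ^ 3) ^ 4 = - 1"
    using z by algebra+
  have root2: "(- (z ^ 2)) ^ 2 = - 1" "(z ^ 2) ^ 2 = - 1"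
    using z by algebra+
  have diff: "- (z ^ 3) - (- (z ^ 3)) ^ 3 = s" "z - z ^ 3 = s" "- z - (- z) ^ 3 = - s"
    "z ^ 3 - (z ^ 3) ^ 3 = - s"
    using cube' unfolding s_def by simp_all
  show ?thesis
    using d0 d4 d1[OF v(2) root4(1) diff(1)] d1[OF v(8) z diff(2)]
      d2[OF v(3) root2(1)] d2[OF v(7) root2(2)]
      d3[OF v(4) root4(2) diff(3)] d3[OF v(6) root4(3) diff(4)] by blast
qed

end
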